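(* Let $(\phi_h^1,\mu_h^{1/2})\in S_h\times S_h$ be the unique solution of the first-step problem: for all $\nu,\psi\in S_h$, $$\Big(\tfrac{\phi_h^1-\phi_h^0}{\tau},\nu\Big)+\varepsilon\,a(\mu_h^{1/2},\nu)=0,$$ $$\varepsilon^{-1}\big(\chi(\phi_h^1,\phi_h^0),\psi\big)-\varepsilon^{-1}(\phi_h^0,\psi)+\tfrac{\tau}{2}a(\mu_h^0,\psi)+\varepsilon\,a\big(\tfrac12\phi_h^1+\tfrac12\phi_h^0,\psi\big)-(\mu_h^{1/2},\psi)=0.$$ Then, for any $h,\tau>0$, $$E(\phi_h^1)+\tau\varepsilon\|\nabla\mu_h^{1/2}\|_{L^2}^2+\frac{1}{4\varepsilon}\|\phi_h^1-\phi_h^0\|_{L^2}^2\le E(\phi_h^0)+\frac{\varepsilon\tau^2}{4}\|\Delta_h\mu_h^0\|_{L^2}^2.$$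
   Context: $\Omega\subset\mathbb{R}^d$, $d\in\{2,3\}$, is an open polygonal or polyhedral domain; $\varepsilon>0$; $(\cdot,\cdot)$ is the $L^2(\Omega)$ inner product and $a(u,v):=(\nabla u,\nabla v)$. $\mathcal{T}_h$ is a conforming, shape-regular, quasi-uniform triangulation of $\Omega$, $q\ge1$ is an integer, $S_h:=\{v\in C^0(\Omega): v|_K\in\mathcal{P}_q(K)\ \forall K\in\mathcal{T}_h\}\subset H^1(\Omega)$, and $\mathring S_h:=S_h\cap L^2_0(\Omega)$ (zero-mean functions). The discrete Laplacian $\Delta_h:S_h\to\mathring S_h$ is defined by $(\Delta_hv_h,\xi)=-a(v_h,\xi)$ for all $\xi\in S_h$. The nonlinearity is $\chi(u,v):=\tfrac12(u^2+v^2)\cdot\tfrac12(u+v)$. The energy is $$E(\phi)=\int_\Omega\Big\{\frac1{4\varepsilon}(\phi^2-1)^2+\frac{\varepsilon}{2}|\nabla\phi|^2\Big\}dx .$$ Initial data: $\phi_h^0=R_h\phi_0$, $\mu_h^0=R_h\mu_0$, with $\phi_0\in H^2(\Omega)$, $\partial_n\phi_0=0$ on $\partial\Omega$, $\mu_0:=\varepsilon^{-1}(\phi_0^3-\phi_0)-\varepsilon\Delta\phi_0\in H^1(\Omega)$, where the Ritz projection $R_h:H^1(\Omega)\to S_h$ is defined by $a(R_h\phi-\phi,\xi)=0$ for all $\xi\in S_h$ and $(R_h\phi-\phi,1)=0$. The first-step problem is uniquely solvable. *)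

theory Defs
  imports "HOL-Analysis.Analysis"
begin

section \<open>Domain, meshes and finite element space\<close>

text \<open>The last condition excludes domains with slits, because it forces the domain to be the
  interior of its closure.\<close>

definition polyhedral_domain :: "(real^'d) set \<Rightarrow> bool" where
  "polyhedral_domain \<Omega> \<longleftrightarrow>
     open \<Omega> \<and> connected \<Omega> \<and> \<Omega> \<noteq> {} \<and>
     (\<exists>P. finite P \<and> (\<forall>K\<in>P. polytope K) \<and> \<Omega> = interior (\<Union>P))"

definition conforming_triangulation :: "(real^'d) set \<Rightarrow> (real^'d) set set \<Rightarrow> bool" where
  "conforming_triangulation \<Omega> T \<longleftrightarrow>
     triangulation T \<and> (\<forall>K\<in>T. int CARD('d) simplex K) \<and> \<Union>T = closure \<Omega>"

definition mesh_size :: "(real^'d) set set \<Rightarrow> real" where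
  "mesh_size T = Max (diameter ` T)"

text \<open>A family of meshes is a map \<open>T\<close> on a set \<open>H\<close> of admissible mesh sizes; the constants of
  shape regularity and quasi-uniformity do not depend on \<open>h \<in> H\<close>.\<close>

definition shape_regular :: "real set \<Rightarrow> (real \<Rightarrow> (real^'d) set set) \<Rightarrow> bool" where
  "shape_regular H T \<longleftrightarrow>
     (\<exists>\<sigma>>0. \<forall>h\<in>H. \<forall>K\<in>T h. \<exists>z. ball z (\<sigma> * diameter K) \<subseteq> K)"

definition quasi_uniform :: "real set \<Rightarrow> (real \<Rightarrow> (real^'d) set set) \<Rightarrow> bool" where
  "quasi_uniform H T \<longleftrightarrow> (\<exists>\<rho>>0. \<forall>h\<in>H. \<forall>K\<in>T h. \<rho> * h \<le> diameter K)"

definition mesh_family :: "(real^'d) set \<Rightarrow> real set \<Rightarrow> (real \<Rightarrow> (real^'d) set set) \<Rightarrow> bool" where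
  "mesh_family \<Omega> H T \<longleftrightarrow>
     H \<subseteq> {0<..} \<and>
     (\<forall>h\<in>H. conforming_triangulation \<Omega> (T h) \<and> mesh_size (T h) = h) \<and>
     shape_regular H T \<and> quasi_uniform H T"

definition polys :: "nat \<Rightarrow> (real^'d \<Rightarrow> real) set" where
  "polys q =
     {p. \<exists>c. p = (\<lambda>x. \<Sum>\<alpha> | sum \<alpha> (UNIV :: 'd set) \<le> q. c \<alpha> * (\<Prod>i\<in>UNIV. (x $ i) ^ \<alpha> i))}"

text \<open>Functions on \<open>\<Omega>\<close> are represented by total functions on \<open>\<real>\<^sup>d\<close> whose values
  outside \<open>\<Omega>\<close> are irrelevant.\<close>

definition fe_space :: "(real^'d) set \<Rightarrow> (real^'d) set set \<Rightarrow> nat \<Rightarrow> (real^'d \<Rightarrow> real) set" where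
  "fe_space \<Omega> T q =
     {v. continuous_on \<Omega> v \<and> (\<forall>K\<in>T. \<exists>p\<in>polys q. \<forall>x\<in>K \<inter> \<Omega>. v x = p x)}"

section \<open>Lebesgue and Sobolev spaces\<close>

definition L2 :: "(real^'d) set \<Rightarrow> (real^'d \<Rightarrow> real) set" where
  "L2 \<Omega> = {u. u \<in> borel_measurable (lebesgue_on \<Omega>) \<and> integrable (lebesgue_on \<Omega>) (\<lambda>x. (u x)\<^sup>2)}"

definition l2_inner :: "(real^'d) set \<Rightarrow> (real^'d \<Rightarrow> real) \<Rightarrow> (real^'d \<Rightarrow> real) \<Rightarrow> real" where
  "l2_inner \<Omega> u v = (\<integral>x. u x * v x \<partial>lebesgue_on \<Omega>)"

definition l2_norm :: "(real^'d) set \<Rightarrow> (real^'d \<Rightarrow> 'b::real_normed_vector) \<Rightarrow> real" where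
  "l2_norm \<Omega> u = sqrt (\<integral>x. (norm (u x))\<^sup>2 \<partial>lebesgue_on \<Omega>)"

definition zero_mean :: "(real^'d) set \<Rightarrow> (real^'d \<Rightarrow> real) set \<Rightarrow> (real^'d \<Rightarrow> real) set" where
  "zero_mean \<Omega> S = {v\<in>S. l2_inner \<Omega> v (\<lambda>_. 1) = 0}"

definition C1_with_gradient :: "(real^'d \<Rightarrow> real) \<Rightarrow> (real^'d \<Rightarrow> real^'d) \<Rightarrow> bool" where
  "C1_with_gradient \<psi> g \<longleftrightarrow> (\<forall>x. GDERIV \<psi> x :> g x) \<and> continuous_on UNIV g"

definition locally_integrable :: "(real^'d) set \<Rightarrow> (real^'d \<Rightarrow> 'b::euclidean_space) \<Rightarrow> bool" where
  "locally_integrable \<Omega> f \<longleftrightarrow> (\<forall>K. compact K \<and> K \<subseteq> \<Omega> \<longrightarrow> f absolutely_integrable_on K)"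

text \<open>Weak first derivatives are tested with compactly supported \<open>C\<^sup>1\<close> functions, the convention
  of Gilbarg and Trudinger.\<close>

definition has_weak_gradient ::
    "(real^'d) set \<Rightarrow> (real^'d \<Rightarrow> real) \<Rightarrow> (real^'d \<Rightarrow> real^'d) \<Rightarrow> bool" where
  "has_weak_gradient \<Omega> u G \<longleftrightarrow>
     locally_integrable \<Omega> u \<and> locally_integrable \<Omega> G \<and>
     (\<forall>\<psi> g. C1_with_gradient \<psi> g \<and> compact (closure {x. \<psi> x \<noteq> 0}) \<and> closure {x. \<psi> x \<noteq> 0} \<subseteq> \<Omega> \<longrightarrow>
        (\<integral>x. u x *\<^sub>R g x \<partial>lebesgue_on \<Omega>) = - (\<integral>x. \<psi> x *\<^sub>R G x \<partial>lebesgue_on \<Omega>))"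

text \<open>A weak gradient is unique only up to null sets; a representative is chosen.\<close>

definition weak_grad :: "(real^'d) set \<Rightarrow> (real^'d \<Rightarrow> real) \<Rightarrow> real^'d \<Rightarrow> real^'d" where
  "weak_grad \<Omega> u = (SOME G. has_weak_gradient \<Omega> u G)"

definition H1 :: "(real^'d) set \<Rightarrow> (real^'d \<Rightarrow> real) set" where
  "H1 \<Omega> = {u\<in>L2 \<Omega>. \<exists>G. has_weak_gradient \<Omega> u G \<and> (\<forall>i. (\<lambda>x. G x $ i) \<in> L2 \<Omega>)}"

definition H2 :: "(real^'d) set \<Rightarrow> (real^'d \<Rightarrow> real) set" where
  "H2 \<Omega> = {u\<in>H1 \<Omega>. \<forall>i. (\<lambda>x. weak_grad \<Omega> u x $ i) \<in> H1 \<Omega>}"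

definition laplacian :: "(real^'d) set \<Rightarrow> (real^'d \<Rightarrow> real) \<Rightarrow> real^'d \<Rightarrow> real" where
  "laplacian \<Omega> u x = (\<Sum>i\<in>UNIV. weak_grad \<Omega> (\<lambda>y. weak_grad \<Omega> u y $ i) x $ i)"

section \<open>Traces and the homogeneous Neumann condition\<close>

text \<open>For a unit vector \<open>n\<close>, this is the \<open>(d-1)\<close>-dimensional Lebesgue measure on the hyperplane
  \<open>{x. n \<bullet> x = c}\<close>: the surface measure of a set \<open>A\<close> in it is the volume of
  the right prism of height 1 over \<open>A\<close>.\<close>

definition hyperplane_measure :: "real^'d \<Rightarrow> real \<Rightarrow> (real^'d) measure" where
  "hyperplane_measure n c =
     distr (restrict_space lborel {x. 0 \<le> n \<bullet> x - c \<and> n \<bullet> x - c \<le> 1}) borel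
           (\<lambda>x. x - (n \<bullet> x - c) *\<^sub>R n)"

text \<open>The trace of \<open>w \<in> H\<^sup>1(\<Omega>)\<close> is the limit of the boundary values of functions that are
  \<open>C\<^sup>1\<close> up to the boundary and converge to \<open>w\<close> in \<open>H\<^sup>1(\<Omega>)\<close>. Here it is required to vanish
  on the part of the boundary contained in the hyperplane \<open>{x. n \<bullet> x = c}\<close>.\<close>

definition zero_trace_on_hyperplane ::
    "(real^'d) set \<Rightarrow> real^'d \<Rightarrow> real \<Rightarrow> (real^'d \<Rightarrow> real) \<Rightarrow> bool" where
  "zero_trace_on_hyperplane \<Omega> n c w \<longleftrightarrow>
     (\<exists>W. (\<forall>k. \<exists>g. C1_with_gradient (W k) g) \<and>
        (\<lambda>k::nat. l2_norm \<Omega> (\<lambda>x. W k x - w x)) \<longlonglongrightarrow> 0 \<and>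
        (\<lambda>k. l2_norm \<Omega> (\<lambda>x. weak_grad \<Omega> (W k) x - weak_grad \<Omega> w x)) \<longlonglongrightarrow> 0 \<and>
        (\<lambda>k. \<integral>x. indicator (frontier \<Omega>) x * (W k x)\<^sup>2 \<partial>hyperplane_measure n c) \<longlonglongrightarrow> 0)"

text \<open>The frontier of a polyhedral domain is covered by finitely many hyperplanes. On a face
  contained in \<open>{x. n \<bullet> x = c}\<close> the outer unit normal is \<open>n\<close> or \<open>-n\<close>, and a hyperplane
  containing no face meets the frontier in a surface null set, so that the condition for it is void.\<close>

definition zero_normal_derivative :: "(real^'d) set \<Rightarrow> (real^'d \<Rightarrow> real) \<Rightarrow> bool" where
  "zero_normal_derivative \<Omega> \<phi> \<longleftrightarrow>
     (\<forall>n c. norm n = 1 \<longrightarrow> zero_trace_on_hyperplane \<Omega> n c (\<lambda>x. n \<bullet> weak_grad \<Omega> \<phi> x))"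

section \<open>The scheme\<close>

definition grad_form :: "(real^'d) set \<Rightarrow> (real^'d \<Rightarrow> real) \<Rightarrow> (real^'d \<Rightarrow> real) \<Rightarrow> real" where
  "grad_form \<Omega> u v = (\<integral>x. weak_grad \<Omega> u x \<bullet> weak_grad \<Omega> v x \<partial>lebesgue_on \<Omega>)"

text \<open>The functions selected in the next two definitions exist and are determined on \<open>\<Omega>\<close>;
  the choice operator is needed only because the values outside \<open>\<Omega>\<close> are arbitrary.\<close>

definition discrete_laplacian ::
    "(real^'d) set \<Rightarrow> (real^'d \<Rightarrow> real) set \<Rightarrow> (real^'d \<Rightarrow> real) \<Rightarrow> real^'d \<Rightarrow> real" where
  "discrete_laplacian \<Omega> S v =
     (SOME w. w \<in> zero_mean \<Omega> S \<and> (\<forall>\<xi>\<in>S. l2_inner \<Omega> w \<xi> = - grad_form \<Omega> v \<xi>))"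

definition ritz_projection ::
    "(real^'d) set \<Rightarrow> (real^'d \<Rightarrow> real) set \<Rightarrow> (real^'d \<Rightarrow> real) \<Rightarrow> real^'d \<Rightarrow> real" where
  "ritz_projection \<Omega> S \<phi> =
     (SOME w. w \<in> S \<and> (\<forall>\<xi>\<in>S. grad_form \<Omega> (\<lambda>x. w x - \<phi> x) \<xi> = 0) \<and>
        l2_inner \<Omega> (\<lambda>x. w x - \<phi> x) (\<lambda>_. 1) = 0)"

definition chi :: "real \<Rightarrow> real \<Rightarrow> real" where
  "chi u v = 1/2 * (u\<^sup>2 + v\<^sup>2) * (1/2 * (u + v))"

definition energy :: "(real^'d) set \<Rightarrow> real \<Rightarrow> (real^'d \<Rightarrow> real) \<Rightarrow> real" where
  "energy \<Omega> \<epsilon> \<phi> =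
     (\<integral>x. 1 / (4 * \<epsilon>) * ((\<phi> x)\<^sup>2 - 1)\<^sup>2 + \<epsilon> / 2 * (norm (weak_grad \<Omega> \<phi> x))\<^sup>2 \<partial>lebesgue_on \<Omega>)"

end

theory Submission
  imports Defs
begin

text \<open>Testing the two equations with \<open>\<tau> \<mu>\<^sub>h\<close> and \<open>\<phi>\<^sub>h\<^sup>1 - \<phi>\<^sub>h\<^sup>0\<close> gives an energy identity whose only
  term without a sign is \<open>- \<tau>/2 a(\<mu>\<^sub>h\<^sup>0, \<phi>\<^sub>h\<^sup>1 - \<phi>\<^sub>h\<^sup>0)\<close>. It equals
  \<open>\<tau>/2 (\<Delta>\<^sub>h \<mu>\<^sub>h\<^sup>0, \<phi>\<^sub>h\<^sup>1 - \<phi>\<^sub>h\<^sup>0)\<close>, and Young's inequality absorbs it in half of the square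
  \<open>1/(2\<epsilon>) \<parallel>\<phi>\<^sub>h\<^sup>1 - \<phi>\<^sub>h\<^sup>0\<parallel>\<^sup>2\<close>.

  Since weak gradients, the discrete Laplacian and the Ritz projection are given by choice
  operators, most of the work is to show that these objects exist and behave linearly: weak gradients
  are unique almost everywhere, finite element functions have them because their products with test
  functions are Lipschitz, and the two projections exist by finite-dimensional linear algebra.\<close>

section \<open>Continuously differentiable functions and the fundamental lemma\<close>

text \<open>Since \<open>weak_grad\<close> picks an unspecified representative, even its linearity
  holds only almost everywhere and rests on uniqueness. Uniqueness needs enough test functions to
  detect a locally integrable field; as these need only be C^1, squared positive parts of affine
  coordinates suffice to build them. For gradients of finite element functions, the Lipschitz route
  replaces integration by parts on simplices: cells are closed, so adjacent polynomials both equal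
  the function on a common face inside \<Omega>, the pieces glue without surface terms, and only the
  null set of cell frontiers is lost. The projections cannot rely on a definite inner product,
  because functions are total and their values outside \<Omega> are invisible to every integral;
  hence a Riesz representation for degenerate forms. In the final estimate the weights of Young's
  inequality are forced: half of the square has to survive, and completing the square with the rest
  leaves exactly \<epsilon>\<tau>^2/4.\<close>

lemma C1_const: "C1_with_gradient (\<lambda>_. c) (\<lambda>_. 0)"
  by (simp add: C1_with_gradient_def GDERIV_const)

lemma C1_coord: "C1_with_gradient (\<lambda>x. x $ i) (\<lambda>_. axis i 1)"
  using bounded_linear_imp_has_derivative[OF bounded_linear_vec_nth]
  by (auto simp: C1_with_gradient_def gderiv_def inner_axis)

lemma C1_add:
  "C1_with_gradient f F \<Longrightarrow> C1_with_gradient g G \<Longrightarrow>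
     C1_with_gradient (\<lambda>x. f x + g x) (\<lambda>x. F x + G x)"
  by (auto simp: C1_with_gradient_def intro: GDERIV_add continuous_on_add)

lemma C1_continuous: "C1_with_gradient f F \<Longrightarrow> continuous_on A f"
  by (auto simp: C1_with_gradient_def gderiv_def
      intro!: continuous_at_imp_continuous_on has_derivative_continuous)

lemma C1_mult:
  "C1_with_gradient f F \<Longrightarrow> C1_with_gradient g G \<Longrightarrow>
     C1_with_gradient (\<lambda>x. f x * g x) (\<lambda>x. f x *\<^sub>R G x + g x *\<^sub>R F x)"
  using C1_continuous[of f F UNIV] C1_continuous[of g G UNIV]
  by (auto simp: C1_with_gradient_def intro: GDERIV_mult continuous_on_add continuous_on_scaleR)

lemma C1_sum:
  assumes "\<And>i. i \<in> I \<Longrightarrow> \<exists>F. C1_with_gradient (f i) F"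
  shows "\<exists>F. C1_with_gradient (\<lambda>x. \<Sum>i\<in>I. f i x) F"
  using assms
proof (induction I rule: infinite_finite_induct)
  case (insert i I)
  then obtain F G where "C1_with_gradient (f i) F" "C1_with_gradient (\<lambda>x. \<Sum>i\<in>I. f i x) G"
    by blast
  from C1_add[OF this] show ?case using insert by auto
qed (auto intro: C1_const)

lemma C1_prod:
  assumes "\<And>i. i \<in> I \<Longrightarrow> \<exists>F. C1_with_gradient (f i) F"
  shows "\<exists>F. C1_with_gradient (\<lambda>x. \<Prod>i\<in>I. f i x) F"
  using assms
proof (induction I rule: infinite_finite_induct)
  case (insert i I)
  then obtain F G where "C1_with_gradient (f i) F" "C1_with_gradient (\<lambda>x. \<Prod>i\<in>I. f i x) G"
    by blast
  from C1_mult[OF this] show ?case using insert by auto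
qed (auto intro: C1_const)

lemma C1_power:
  assumes "C1_with_gradient f F"
  shows "\<exists>G. C1_with_gradient (\<lambda>x. f x ^ n) G"
  using C1_prod[of "{..<n}" "\<lambda>_. f"] assms by auto

text \<open>Differentiability and continuity of the derivative are asked for only at values of
  \<open>f\<close>, so that \<open>\<theta>\<close> may have a pole elsewhere, as 1 - 1/(1 + n s)
  has for negative s.\<close>

lemma C1_compose:
  assumes "C1_with_gradient f F" "\<And>x. (\<theta> has_real_derivative \<theta>' (f x)) (at (f x))"
    and "continuous_on (range f) \<theta>'"
  shows "C1_with_gradient (\<lambda>x. \<theta> (f x)) (\<lambda>x. \<theta>' (f x) *\<^sub>R F x)"
proof -
  have "continuous_on UNIV (\<lambda>x. \<theta>' (f x))"
    by (rule continuous_on_compose2[OF assms(3) C1_continuous[OF assms(1)]]) simp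
  moreover have "GDERIV (\<lambda>x. \<theta> (f x)) x :> \<theta>' (f x) *\<^sub>R F x" for x
    using assms(1,2) by (intro GDERIV_DERIV_compose) (auto simp: C1_with_gradient_def)
  ultimately show ?thesis
    using assms(1) by (simp add: C1_with_gradient_def continuous_on_scaleR)
qed

text \<open>Squaring the positive part removes its kink at 0 and leaves a continuous derivative,
  which gives C^1 cut-offs by elementary formulas.\<close>

lemma DERIV_max0_square: "((\<lambda>t::real. (max 0 t)\<^sup>2) has_real_derivative 2 * max 0 t) (at t)"
proof -
  consider "t > 0" | "t < 0" | "t = 0" by linarith
  then show ?thesis
  proof cases
    case 1
    have "((\<lambda>t::real. t\<^sup>2) has_real_derivative 2 * t) (at t)"
      by (auto intro!: derivative_eq_intros)
    then show ?thesis
      by (rule has_field_derivative_transform_within_open[of _ _ _ "{0<..}", THEN DERIV_cong]) (use 1 in auto)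
  next
    case 2
    have "((\<lambda>t::real. 0) has_real_derivative 0) (at t)" by simp
    then show ?thesis
      by (rule has_field_derivative_transform_within_open[of _ _ _ "{..<0}", THEN DERIV_cong]) (use 2 in auto)
  next
    case 3
    \<comment> \<open>At 0 the difference quotient is 0 from the left and \<open>h\<close> from the
      right.\<close>
    have "((\<lambda>h::real. (max 0 h)\<^sup>2 / h) \<longlongrightarrow> 0) (at 0)"
    proof (rule Lim_null_comparison)
      show "\<forall>\<^sub>F h in at 0. norm ((max 0 h)\<^sup>2 / h) \<le> \<bar>h\<bar>"
        by (auto simp: eventually_at_filter power2_eq_square max_def intro!: always_eventually)
      show "((\<lambda>h::real. \<bar>h\<bar>) \<longlongrightarrow> 0) (at 0)"
        by (intro tendsto_eq_intros) auto
    qed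
    then show ?thesis using 3 by (simp add: DERIV_def)
  qed
qed

text \<open>The factors are squared positive parts of x_i - a_i and b_i - x_i, so the product is
  nonzero exactly when all strict inequalities of the open box hold; an empty box gives the zero
  function.\<close>

lemma C1_box_bump:
  fixes a b :: "real^'d"
  obtains f F where "C1_with_gradient f F" "\<And>x. 0 \<le> f x" "\<And>x. f x \<noteq> 0 \<longleftrightarrow> x \<in> box a b"
proof -
  let ?m = "\<lambda>t::real. (max 0 t)\<^sup>2"
  \<comment> \<open>The shape \<open>x $ i + (- a $ i)\<close> and
    \<open>(-1) * x $ i + b $ i\<close> matches the closure rules for sums and products
    literally.\<close>
  define f where "f x = (\<Prod>i\<in>UNIV. ?m (x $ i + (- a $ i)) * ?m ((-1) * x $ i + b $ i))" for x :: "real^'d"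
  have m: "\<exists>F. C1_with_gradient (\<lambda>x. ?m (f x)) F" if "C1_with_gradient f F" for f and F :: "real^'d \<Rightarrow> real^'d"
    by (rule exI, rule C1_compose[OF that DERIV_max0_square]) (intro continuous_intros)
  have "\<exists>F. C1_with_gradient (\<lambda>x. ?m (x $ i + (- a $ i)) * ?m ((-1) * x $ i + b $ i)) F" for i
    using m[OF C1_add[OF C1_coord C1_const], of i "- a $ i"]
      m[OF C1_add[OF C1_mult[OF C1_const C1_coord] C1_const], of "-1" i "b $ i"]
    by (auto dest: C1_mult)
  then have "\<exists>F. C1_with_gradient f F"
    unfolding f_def by (intro C1_prod) auto
  moreover have "0 \<le> f x" for x
    unfolding f_def by (intro prod_nonneg) auto
  moreover have "f x \<noteq> 0 \<longleftrightarrow> x \<in> box a b" for x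
  proof -
    have "?m (x $ i + (- a $ i)) * ?m ((-1) * x $ i + b $ i) \<noteq> 0 \<longleftrightarrow> a $ i < x $ i \<and> x $ i < b $ i" for i
      by (auto simp: max_def)
    then show ?thesis
      unfolding f_def mem_box_cart by (subst prod_zero_iff) (simp, blast)
  qed
  ultimately show ?thesis using that by blast
qed

lemma C1_approx_indicator_box:
  fixes a b :: "real^'d"
  obtains \<psi> G where "\<And>n::nat. C1_with_gradient (\<psi> n) (G n)"
    "\<And>n x. 0 \<le> \<psi> n x \<and> \<psi> n x \<le> 1" "\<And>n x. \<psi> n x \<noteq> 0 \<Longrightarrow> x \<in> box a b"
    "\<And>x. (\<lambda>n. \<psi> n x) \<longlonglongrightarrow> indicator (box a b) x"
proof -
  obtain f F where f: "C1_with_gradient f F" "\<And>x. 0 \<le> f x" "\<And>x. f x \<noteq> 0 \<longleftrightarrow> x \<in> box a b"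
    by (rule C1_box_bump[of a b]) blast
  \<comment> \<open>This is n s/(1 + n s): for s \<ge> 0 it lies in [0, 1), it fixes 0, and it tends
    to 1 for every s > 0. Applied to the bump it converges to the indicator of the box.\<close>
  define \<theta> where "\<theta> n s = 1 - 1 / (1 + real n * s)" for n s
  define \<theta>' where "\<theta>' n s = real n / (1 + real n * s)\<^sup>2" for n s
  have pos: "1 + real n * f x > 0" for n x
    using f(2)[of x] by (simp add: add_pos_nonneg)
  have "C1_with_gradient (\<lambda>x. \<theta> n (f x)) (\<lambda>x. \<theta>' n (f x) *\<^sub>R F x)" for n
  proof (rule C1_compose[OF f(1)])
    show "(\<theta> n has_real_derivative \<theta>' n (f x)) (at (f x))" for x
      unfolding \<theta>_def \<theta>'_def using pos[of n x]
      by (auto intro!: derivative_eq_intros simp: power2_eq_square)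
    show "continuous_on (range f) (\<theta>' n)"
      unfolding \<theta>'_def by (intro continuous_intros) (metis imageE pos power_not_zero less_irrefl)
  qed
  moreover have "0 \<le> \<theta> n (f x) \<and> \<theta> n (f x) \<le> 1" for n x
    using pos[of n x] f(2)[of x] by (auto simp: \<theta>_def)
  moreover have "\<theta> n (f x) \<noteq> 0 \<Longrightarrow> x \<in> box a b" for n x
    using f(3)[of x] by (auto simp: \<theta>_def)
  moreover have "(\<lambda>n. \<theta> n (f x)) \<longlonglongrightarrow> indicator (box a b) x" for x
  proof (cases "x \<in> box a b")
    case True
    then have fx: "f x > 0" using f(2)[of x] f(3)[of x] by auto
    have "filterlim (\<lambda>n. 1 + real n * f x) at_top sequentially"
      using fx by (intro filterlim_tendsto_add_at_top[OF tendsto_const]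
          filterlim_at_top_mult_tendsto_pos[OF tendsto_const]) (auto simp: filterlim_real_sequentially)
    then have "(\<lambda>n. 1 / (1 + real n * f x)) \<longlonglongrightarrow> 0"
      by (intro real_tendsto_divide_at_top[OF tendsto_const])
    then have "(\<lambda>n. 1 - 1 / (1 + real n * f x)) \<longlonglongrightarrow> 1 - 0"
      by (intro tendsto_diff tendsto_const)
    then show ?thesis using True by (simp add: \<theta>_def)
  next
    case False
    then have "f x = 0" using f(3)[of x] by auto
    then show ?thesis using False by (simp add: \<theta>_def)
  qed
  ultimately show ?thesis by (rule that)
qed

section \<open>Integrable functions with vanishing box integrals\<close>

lemma sigma_finite_lebesgue: "sigma_finite_measure (lebesgue :: 'a::euclidean_space measure)"
proof -
  obtain A :: "'a set set" where "countable A" "A \<subseteq> sets lborel" "\<Union>A = space lborel"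
      "\<forall>a\<in>A. emeasure lborel a \<noteq> \<infinity>"
    using lborel.sigma_finite_countable by blast
  then show ?thesis
    by unfold_locales (intro exI[of _ A], auto simp: subset_eq)
qed

text \<open>Open boxes are stable under intersection and generate the Borel sets, so a Dynkin
  argument spreads the vanishing of the integral to all Borel sets; Lebesgue sets differ from these
  only by null sets.\<close>

lemma AE_zero_if_set_integral_box_zero:
  fixes f :: "'a::euclidean_space \<Rightarrow> 'b::euclidean_space"
  assumes int: "integrable lebesgue f"
    and box: "\<And>a b. (\<integral>x\<in>box a b. f x \<partial>lebesgue) = 0"
  shows "AE x in lebesgue. f x = 0"
proof (rule sigma_finite_measure.density_zero[OF sigma_finite_lebesgue int])
  fix A :: "'a set" assume "A \<in> sets lebesgue"
  then obtain B N N' where A: "A = B \<union> N" "N \<subseteq> N'" "N' \<in> null_sets lborel" "B \<in> sets lborel"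
    by (rule sets_completionE)
  have iB: "set_integrable lebesgue C f" if "C \<in> sets lebesgue" for C
    using int that by (simp add: set_integrable_def integrable_mult_indicator)
  have UN: "(\<Union>n::nat. box (- (real n *\<^sub>R One)) (real n *\<^sub>R One)) = (UNIV :: 'a set)"
    by (rule UN_box_eq_UNIV)
  \<comment> \<open>The complement step of the induction subtracts from the integral over the whole
    space, which is the limit over growing centred boxes.\<close>
  have tot: "integral\<^sup>L lebesgue f = 0"
  proof -
    have "(\<lambda>n. \<integral>x\<in>box (- (real n *\<^sub>R One)) (real n *\<^sub>R One). f x \<partial>lebesgue)
           \<longlonglongrightarrow> (\<integral>x\<in>(\<Union>n::nat. box (- (real n *\<^sub>R One)) (real n *\<^sub>R One)). f x \<partial>lebesgue)"
    proof (rule set_integral_cont_up)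
      show "incseq (\<lambda>n. box (- (real n *\<^sub>R One)) (real n *\<^sub>R One :: 'a))"
        unfolding incseq_def
      proof (intro allI impI subsetI)
        fix m n :: nat and x :: 'a assume "m \<le> n" and x: "x \<in> box (- (real m *\<^sub>R One)) (real m *\<^sub>R One)"
        then have "real m \<le> real n" by simp
        then show "x \<in> box (- (real n *\<^sub>R One)) (real n *\<^sub>R One)"
          using x by (fastforce simp: mem_box)
      qed
      show "set_integrable lebesgue (\<Union>n::nat. box (- (real n *\<^sub>R One)) (real n *\<^sub>R One)) f"
        unfolding UN by (rule iB) simp
    qed simp
    then show ?thesis
      unfolding UN box by (auto simp: LIMSEQ_const_iff set_lebesgue_integral_def)
  qed
  have "Int_stable (range (\<lambda>(a, b). box a b :: 'a set))"
    by (auto simp: Int_stable_def box_Int_box)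
  moreover have "range (\<lambda>(a, b). box a b :: 'a set) \<subseteq> Pow UNIV"
    by auto
  moreover have "B \<in> sigma_sets UNIV (range (\<lambda>(a, b). box a b))"
    using A(4) unfolding sets_lborel borel_eq_box by simp
  ultimately have "(\<integral>x\<in>B. f x \<partial>lebesgue) = 0"
  proof (induction B rule: sigma_sets_induct_disjoint)
    case (basic A) then show ?case by (auto simp: box)
  next
    case empty then show ?case by (simp add: set_lebesgue_integral_def)
  next
    case (compl A)
    then have "A \<in> sets borel" by (simp add: borel_eq_box)
    then have "A \<in> sets lebesgue" by simp
    have "(\<integral>x\<in>A \<union> (UNIV - A). f x \<partial>lebesgue) = (\<integral>x\<in>A. f x \<partial>lebesgue) + (\<integral>x\<in>UNIV - A. f x \<partial>lebesgue)"
      by (rule set_integral_Un) (use \<open>A \<in> sets lebesgue\<close> in \<open>auto intro!: iB\<close>)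
    then show ?case using tot compl by (simp add: set_lebesgue_integral_def)
  next
    case (union F)
    then have *: "F i \<in> sets lebesgue" for i
    proof -
      have "F i \<in> sets borel" using union(2) by (auto simp: borel_eq_box)
      then show ?thesis by simp
    qed
    have "(\<integral>x\<in>(\<Union>i. F i). f x \<partial>lebesgue) = (\<Sum>i. (\<integral>x\<in>F i. f x \<partial>lebesgue))"
      by (rule lebesgue_integral_countable_add)
        (use union(1) * in \<open>auto simp: disjoint_family_on_def intro!: iB\<close>)
    then show ?case using union by simp
  qed
  moreover have "(\<integral>x\<in>A. f x \<partial>lebesgue) = (\<integral>x\<in>B. f x \<partial>lebesgue)"
  proof (rule set_integral_null_delta)
    show "sym_diff A B \<in> null_sets lebesgue"
      using A by (auto intro: null_sets_completion_subset[of _ N'] null_sets_completionI)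
    show "integrable lebesgue f" by (rule int)
    show "A \<in> sets lebesgue" "B \<in> sets lebesgue" using A \<open>A \<in> sets lebesgue\<close> by auto
  qed
  ultimately show "(\<integral>x\<in>A. f x \<partial>lebesgue) = 0" by simp
qed

text \<open>An abbreviation, not a definition: it is literally the premise in
  \<open>has_weak_gradient\<close>, so unfolded facts apply without conversion.\<close>

abbreviation test_function :: "(real^'d) set \<Rightarrow> (real^'d \<Rightarrow> real) \<Rightarrow> (real^'d \<Rightarrow> real^'d) \<Rightarrow> bool" where
  "test_function \<Omega> \<psi> g \<equiv> C1_with_gradient \<psi> g \<and> compact (closure {x. \<psi> x \<noteq> 0}) \<and>
     closure {x. \<psi> x \<noteq> 0} \<subseteq> \<Omega>"

text \<open>Integrability is available only on compact subsets, so the argument runs on closed boxes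
  inside \<Omega>, where the extension by zero is integrable on the whole space. Countably many such
  boxes exhaust \<Omega>, so the exceptional null sets form a null set.\<close>

lemma fundamental_lemma_calculus_of_variations:
  fixes \<Omega> :: "(real^'d) set" and f :: "real^'d \<Rightarrow> 'b::euclidean_space"
  assumes "open \<Omega>" and loc: "locally_integrable \<Omega> f"
    and test: "\<And>\<psi> g. test_function \<Omega> \<psi> g \<Longrightarrow> (\<integral>x. \<psi> x *\<^sub>R f x \<partial>lebesgue_on \<Omega>) = 0"
  shows "AE x in lebesgue_on \<Omega>. f x = 0"
proof -
  have \<Omega>: "\<Omega> \<in> sets lebesgue" using \<open>open \<Omega>\<close> by simp
  have AE_box: "AE x in lebesgue. x \<in> cbox c d \<longrightarrow> f x = 0" if sub: "cbox c d \<subseteq> \<Omega>" for c d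
  proof -
    let ?f = "\<lambda>x. indicator (cbox c d) x *\<^sub>R f x"
    have int: "integrable lebesgue ?f"
      using loc sub by (auto simp: locally_integrable_def set_integrable_def)
    have "(\<integral>x\<in>box a b. ?f x \<partial>lebesgue) = 0" for a b
    proof -
      \<comment> \<open>The supports must stay in the compact set \<open>cbox c d\<close>, so the
        cut-offs approximate the intersection with its interior, which is again an open box.\<close>
      obtain a' b' where ab': "box a b \<inter> box c d = box a' b'"
        unfolding box_Int_box by blast
      obtain \<psi> G where \<psi>: "\<And>n::nat. C1_with_gradient (\<psi> n) (G n)"
          "\<And>n x. 0 \<le> \<psi> n x \<and> \<psi> n x \<le> 1" "\<And>n x. \<psi> n x \<noteq> 0 \<Longrightarrow> x \<in> box a' b'"
          "\<And>x. (\<lambda>n. \<psi> n x) \<longlonglongrightarrow> indicator (box a' b') x"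
        by (rule C1_approx_indicator_box[of a' b']) blast
      have in_cbox: "x \<in> cbox c d" if "\<psi> n x \<noteq> 0" for n x
        using \<psi>(3)[OF that] ab' box_subset_cbox by auto
      have cl: "closure {x. \<psi> n x \<noteq> 0} \<subseteq> cbox c d" for n
        by (intro closure_minimal) (use in_cbox in auto)
      have "compact (closure {x. \<psi> n x \<noteq> 0})" for n
        using cl[of n] bounded_subset[OF bounded_cbox] by (auto simp: compact_eq_bounded_closed)
      then have "test_function \<Omega> (\<psi> n) (G n)" for n
        using \<psi>(1) cl[of n] sub by auto
      note test_\<psi> = test[OF this]
      have zero: "(\<integral>x. \<psi> n x *\<^sub>R ?f x \<partial>lebesgue) = 0" for n
      proof -
        have "\<psi> n x *\<^sub>R ?f x = indicator \<Omega> x *\<^sub>R \<psi> n x *\<^sub>R f x" for x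
          using in_cbox[of n x] sub by (cases "\<psi> n x = 0") (auto simp: indicator_def)
        then have "(\<integral>x. \<psi> n x *\<^sub>R ?f x \<partial>lebesgue) = (\<integral>x. indicator \<Omega> x *\<^sub>R \<psi> n x *\<^sub>R f x \<partial>lebesgue)"
          by (simp only:)
        also have "\<dots> = (\<integral>x. \<psi> n x *\<^sub>R f x \<partial>lebesgue_on \<Omega>)"
          by (subst integral_restrict_space) (use \<Omega> in simp_all)
        finally show ?thesis using test_\<psi>[of n] by simp
      qed
      have meas: "\<psi> n \<in> borel_measurable lebesgue" for n
        using C1_continuous[OF \<psi>(1), of UNIV]
        by (intro measurable_completion) (simp add: borel_measurable_continuous_onI)
      \<comment> \<open>The cut-offs lie between 0 and 1, so \<open>norm (?f x)\<close> is an
        integrable majorant.\<close>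
      have "(\<lambda>n. \<integral>x. \<psi> n x *\<^sub>R ?f x \<partial>lebesgue) \<longlonglongrightarrow> (\<integral>x. indicator (box a' b') x *\<^sub>R ?f x \<partial>lebesgue)"
      proof (rule integral_dominated_convergence[where w = "\<lambda>x. norm (?f x)"])
        show "(\<lambda>x. \<psi> n x *\<^sub>R ?f x) \<in> borel_measurable lebesgue" for n
          by (intro borel_measurable_scaleR meas borel_measurable_integrable[OF int])
        show "(\<lambda>x. indicator (box a' b') x *\<^sub>R ?f x) \<in> borel_measurable lebesgue"
          by (intro borel_measurable_scaleR borel_measurable_indicator borel_measurable_integrable[OF int]) simp
        show "AE x in lebesgue. (\<lambda>n. \<psi> n x *\<^sub>R ?f x) \<longlonglongrightarrow> indicator (box a' b') x *\<^sub>R ?f x"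
          by (intro AE_I2 tendsto_scaleR \<psi>(4) tendsto_const)
        show "integrable lebesgue (\<lambda>x. norm (?f x))"
          by (rule integrable_norm[OF int])
        show "AE x in lebesgue. norm (\<psi> n x *\<^sub>R ?f x) \<le> norm (?f x)" for n
          by (rule AE_I2) (simp only: norm_scaleR, rule mult_left_le_one_le, use \<psi>(2)[of n] in auto)
      qed
      then have "(\<integral>x. indicator (box a' b') x *\<^sub>R ?f x \<partial>lebesgue) = 0"
        unfolding zero by (simp add: LIMSEQ_const_iff)
      moreover have "(\<integral>x\<in>box a b. ?f x \<partial>lebesgue) = (\<integral>x. indicator (box a' b') x *\<^sub>R ?f x \<partial>lebesgue)"
        unfolding set_lebesgue_integral_def
      proof (rule integral_cong_AE)
        \<comment> \<open>Passing to the open box changes the integrand only on the frontier of the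
          closed one.\<close>
        have "cbox c d - box c d \<in> null_sets lebesgue"
          using negligible_frontier_interval[of c d] negligible_iff_null_sets by blast
        then have "AE x in lebesgue. x \<notin> cbox c d - box c d"
          by (rule AE_not_in)
        then show "AE x in lebesgue. indicator (box a b) x *\<^sub>R ?f x = indicator (box a' b') x *\<^sub>R ?f x"
          by eventually_elim (auto simp: indicator_def simp flip: ab')
      qed (intro borel_measurable_scaleR borel_measurable_indicator borel_measurable_integrable[OF int], simp)+
      ultimately show ?thesis by simp
    qed
    then have "AE x in lebesgue. ?f x = 0"
      by (rule AE_zero_if_set_integral_box_zero[OF int])
    then show ?thesis by eventually_elim (auto simp: indicator_def)
  qed
  obtain \<D> where \<D>: "countable \<D>" "\<And>X. X \<in> \<D> \<Longrightarrow> \<exists>a b. X = cbox a b" "\<Union>\<D> = \<Omega>"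
    using open_countable_Union_open_cbox[OF \<open>open \<Omega>\<close>] by metis
  have "AE x in lebesgue. \<forall>X\<in>\<D>. x \<in> X \<longrightarrow> f x = 0"
    using \<D> AE_box by (subst AE_ball_countable) blast+
  then have "AE x in lebesgue. x \<in> \<Omega> \<longrightarrow> f x = 0"
    by eventually_elim (use \<D>(3) in auto)
  then show ?thesis using \<Omega> by (simp add: AE_restrict_space_iff)
qed

section \<open>Weak gradients\<close>

lemma L2_measurable: "u \<in> L2 \<Omega> \<Longrightarrow> u \<in> borel_measurable (lebesgue_on \<Omega>)"
  by (simp add: L2_def)

lemma L2_mult_integrable:
  assumes "u \<in> L2 \<Omega>" "v \<in> L2 \<Omega>"
  shows "integrable (lebesgue_on \<Omega>) (\<lambda>x. u x * v x)"
proof (rule Bochner_Integration.integrable_bound)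
  show "integrable (lebesgue_on \<Omega>) (\<lambda>x. (u x)\<^sup>2 + (v x)\<^sup>2)"
    using assms by (simp add: L2_def)
  show "(\<lambda>x. u x * v x) \<in> borel_measurable (lebesgue_on \<Omega>)"
    by (intro borel_measurable_times assms[THEN L2_measurable])
  have "\<bar>u x * v x\<bar> \<le> (u x)\<^sup>2 + (v x)\<^sup>2" for x
    using sum_squares_bound[of "\<bar>u x\<bar>" "\<bar>v x\<bar>"] abs_ge_zero[of "u x * v x"]
    unfolding abs_mult power2_abs by linarith
  then show "AE x in lebesgue_on \<Omega>. norm (u x * v x) \<le> norm ((u x)\<^sup>2 + (v x)\<^sup>2)"
    by (intro AE_I2) simp
qed

lemma L2_lincomb:
  assumes "u \<in> L2 \<Omega>" "v \<in> L2 \<Omega>"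
  shows "(\<lambda>x. a * u x + b * v x) \<in> L2 \<Omega>"
proof -
  have "(a * u x + b * v x)\<^sup>2 = a\<^sup>2 * (u x)\<^sup>2 + 2 * a * b * (u x * v x) + b\<^sup>2 * (v x)\<^sup>2" for x
    by (simp add: power2_eq_square algebra_simps)
  moreover have "(\<lambda>x. a * u x + b * v x) \<in> borel_measurable (lebesgue_on \<Omega>)"
    by (intro borel_measurable_times borel_measurable_add borel_measurable_const assms[THEN L2_measurable])
  ultimately show ?thesis
    using assms L2_mult_integrable[OF assms] by (simp add: L2_def)
qed

lemma l2_inner_lincomb_left:
  assumes "u \<in> L2 \<Omega>" "v \<in> L2 \<Omega>" "w \<in> L2 \<Omega>"
  shows "l2_inner \<Omega> (\<lambda>x. a * u x + b * v x) w = a * l2_inner \<Omega> u w + b * l2_inner \<Omega> v w"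
  using L2_mult_integrable[OF assms(1,3)] L2_mult_integrable[OF assms(2,3)]
  by (simp add: l2_inner_def distrib_right mult.assoc)

lemma l2_inner_commute: "l2_inner \<Omega> u v = l2_inner \<Omega> v u"
  by (simp add: l2_inner_def mult.commute)

lemma l2_inner_cong:
  assumes "\<And>x. x \<in> \<Omega> \<Longrightarrow> u x = u' x" "\<And>x. x \<in> \<Omega> \<Longrightarrow> v x = v' x"
  shows "l2_inner \<Omega> u v = l2_inner \<Omega> u' v'"
  unfolding l2_inner_def by (rule Bochner_Integration.integral_cong) (use assms in auto)

lemma l2_norm_square: "(l2_norm \<Omega> u)\<^sup>2 = l2_inner \<Omega> u u"
  by (simp add: l2_norm_def l2_inner_def power2_eq_square)

lemma l2_inner_self_nonneg: "0 \<le> l2_inner \<Omega> u u"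
  by (simp add: l2_inner_def)

lemma l2_inner_self_eq_0:
  assumes "u \<in> L2 \<Omega>" "l2_inner \<Omega> u u = 0"
  shows "AE x in lebesgue_on \<Omega>. u x = 0"
  using assms(2) L2_mult_integrable[OF assms(1,1)]
  by (auto simp: l2_inner_def integral_nonneg_eq_0_iff_AE)

text \<open>Local integrability yields measurability only on compact subsets; a countable cover of
  the open set by closed boxes joins the pieces.\<close>

lemma locally_integrable_measurable:
  fixes f :: "real^'d \<Rightarrow> 'b::euclidean_space"
  assumes "open \<Omega>" "locally_integrable \<Omega> f"
  shows "f \<in> borel_measurable (lebesgue_on \<Omega>)"
proof -
  obtain \<D> where \<D>: "countable \<D>" "\<D> \<subseteq> Pow \<Omega>" "\<And>X. X \<in> \<D> \<Longrightarrow> \<exists>a b. X = cbox a b" "\<Union>\<D> = \<Omega>"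
    using open_countable_Union_open_cbox[OF \<open>open \<Omega>\<close>] by metis
  have \<Omega>: "\<Omega> \<in> sets lebesgue" using \<open>open \<Omega>\<close> by simp
  have *: "X \<in> sets lebesgue \<and> X \<subseteq> \<Omega> \<and> f \<in> borel_measurable (lebesgue_on X)" if X: "X \<in> \<D>" for X
  proof -
    obtain a b where [simp]: "X = cbox a b" using \<D>(3)[OF X] by blast
    have "X \<subseteq> \<Omega>" using X \<D>(2) by auto
    then have "f absolutely_integrable_on X"
      using assms(2) by (simp add: locally_integrable_def)
    then show ?thesis using \<open>X \<subseteq> \<Omega>\<close>
      by (auto intro: absolutely_integrable_imp_borel_measurable)
  qed
  show ?thesis
  proof (rule measurable_piecewise_restrict[OF \<D>(1)])
    show "X \<inter> space (lebesgue_on \<Omega>) \<in> sets (lebesgue_on \<Omega>)" if "X \<in> \<D>" for X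
      using *[OF that] \<Omega> by (auto simp: sets_restrict_space_iff Int_absorb2)
    show "space (lebesgue_on \<Omega>) \<subseteq> \<Union>\<D>" by (simp add: \<D>(4))
    show "f \<in> borel_measurable (restrict_space (lebesgue_on \<Omega>) X)" if "X \<in> \<D>" for X
      using *[OF that] by (simp add: restrict_restrict_space \<Omega> Int_absorb1)
  qed
qed

text \<open>The continuous factor is bounded on \<open>K\<close>, which keeps the product
  integrable. The bilinear \<open>h\<close> serves both sides of the weak gradient identity, where
  the scalar and the vector factor swap roles.\<close>

lemma integrable_compact_support_times_locally_integrable:
  fixes h :: "'a::euclidean_space \<Rightarrow> 'b::euclidean_space \<Rightarrow> 'c::euclidean_space"
    and \<Omega> :: "(real^'d) set"
  assumes "bilinear h" "open \<Omega>" "compact K" "K \<subseteq> \<Omega>" "locally_integrable \<Omega> f"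
    and k: "continuous_on UNIV k" "\<And>x. x \<notin> K \<Longrightarrow> k x = 0"
  shows "integrable (lebesgue_on \<Omega>) (\<lambda>x. h (k x) (f x))"
proof -
  have K: "K \<in> sets lebesgue" using \<open>compact K\<close> by (simp add: compact_imp_closed)
  have kK: "continuous_on K k" by (rule continuous_on_subset[OF k(1)]) simp
  have "(\<lambda>x. h (k x) (f x)) absolutely_integrable_on K"
  proof (rule absolutely_integrable_bounded_measurable_product[OF \<open>bilinear h\<close> _ K])
    show "k \<in> borel_measurable (lebesgue_on K)"
      by (rule continuous_imp_measurable_on_sets_lebesgue[OF kK K])
    show "bounded (k ` K)"
      by (rule compact_imp_bounded[OF compact_continuous_image[OF kK \<open>compact K\<close>]])
    show "f absolutely_integrable_on K"
      using assms by (simp add: locally_integrable_def)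
  qed
  then have "integrable lebesgue (\<lambda>x. indicator K x *\<^sub>R h (k x) (f x))"
    by (simp add: set_integrable_def)
  also have "(\<lambda>x. indicator K x *\<^sub>R h (k x) (f x)) = (\<lambda>x. indicator \<Omega> x *\<^sub>R h (k x) (f x))"
  proof
    show "indicator K x *\<^sub>R h (k x) (f x) = indicator \<Omega> x *\<^sub>R h (k x) (f x)" for x
      using \<open>K \<subseteq> \<Omega>\<close> k(2)[of x] bilinear_lzero[OF \<open>bilinear h\<close>]
      by (cases "x \<in> K") (auto simp: indicator_def)
  qed
  finally show ?thesis
    using \<open>open \<Omega>\<close> by (subst integrable_restrict_space) simp_all
qed

text \<open>Off its closed support a test function is locally constant, so its gradient vanishes
  there too.\<close>

lemma test_function_zero_outside:
  assumes "test_function \<Omega> \<psi> g" "x \<notin> closure {x. \<psi> x \<noteq> 0}"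
  shows "\<psi> x = 0" "g x = 0"
proof -
  show "\<psi> x = 0" using assms(2) closure_subset[of "{x. \<psi> x \<noteq> 0}"] by blast
  have "GDERIV \<psi> x :> g x" using assms(1) by (simp add: C1_with_gradient_def)
  then have "(\<psi> has_derivative (\<lambda>h. h \<bullet> g x)) (at x)" by (simp add: gderiv_def)
  moreover have "(\<psi> has_derivative (\<lambda>_. 0)) (at x)"
  proof (rule has_derivative_transform_within_open[where f = "\<lambda>_. 0" and s = "- closure {x. \<psi> x \<noteq> 0}"])
    show "0 = \<psi> y" if "y \<in> - closure {x. \<psi> x \<noteq> 0}" for y
    proof -
      have "\<psi> y = 0" using that closure_subset[of "{x. \<psi> x \<noteq> 0}"] by blast
      then show ?thesis by simp
    qed
  qed (use assms(2) in \<open>simp_all add: open_Compl\<close>)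
  ultimately have "(\<lambda>h. h \<bullet> g x) = (\<lambda>_. 0)" by (rule has_derivative_unique)
  from fun_cong[OF this, of "g x"] show "g x = 0" by simp
qed

lemma test_function_integrable:
  fixes u :: "real^'d \<Rightarrow> real" and G :: "real^'d \<Rightarrow> real^'d"
  assumes "open \<Omega>" "test_function \<Omega> \<psi> g"
  shows "locally_integrable \<Omega> u \<Longrightarrow> integrable (lebesgue_on \<Omega>) (\<lambda>x. u x *\<^sub>R g x)"
    and "locally_integrable \<Omega> G \<Longrightarrow> integrable (lebesgue_on \<Omega>) (\<lambda>x. \<psi> x *\<^sub>R G x)"
proof -
  let ?K = "closure {x. \<psi> x \<noteq> 0}"
  show "integrable (lebesgue_on \<Omega>) (\<lambda>x. u x *\<^sub>R g x)" if "locally_integrable \<Omega> u"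
  proof (rule integrable_compact_support_times_locally_integrable[where K = ?K and h = "\<lambda>v c. c *\<^sub>R v"])
    show "bilinear (\<lambda>v c. c *\<^sub>R v :: real^'d)"
      by (simp add: bilinear_def linear_iff algebra_simps)
    show "g x = 0" if "x \<notin> ?K" for x
      using that by (rule test_function_zero_outside(2)[OF assms(2)])
  qed (use assms that in \<open>simp_all add: C1_with_gradient_def\<close>)
  show "integrable (lebesgue_on \<Omega>) (\<lambda>x. \<psi> x *\<^sub>R G x)" if "locally_integrable \<Omega> G"
  proof (rule integrable_compact_support_times_locally_integrable[where K = ?K and h = "(*\<^sub>R)"])
    show "bilinear ((*\<^sub>R) :: real \<Rightarrow> real^'d \<Rightarrow> real^'d)"
      by (simp add: bilinear_def linear_iff algebra_simps)
    show "\<psi> x = 0" if "x \<notin> ?K" for x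
      using that by (rule test_function_zero_outside(1)[OF assms(2)])
    show "continuous_on UNIV \<psi>" using assms(2) C1_continuous by blast
  qed (use assms that in simp_all)
qed

lemma locally_integrable_lincomb:
  fixes f g :: "real^'d \<Rightarrow> 'b::euclidean_space"
  assumes "locally_integrable \<Omega> f" "locally_integrable \<Omega> g"
  shows "locally_integrable \<Omega> (\<lambda>x. a *\<^sub>R f x + b *\<^sub>R g x)"
  unfolding locally_integrable_def
proof (intro allI impI)
  fix K assume "compact K \<and> K \<subseteq> \<Omega>"
  then have "f absolutely_integrable_on K" "g absolutely_integrable_on K"
    using assms by (simp_all add: locally_integrable_def)
  then show "(\<lambda>x. a *\<^sub>R f x + b *\<^sub>R g x) absolutely_integrable_on K"
    by (intro set_integral_add(1) absolutely_integrable_scaleR_left)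
qed

text \<open>A non-integrable function has Bochner integral 0 by convention, so splitting the
  integrals requires integrability of each product with the test function or its gradient.\<close>

lemma has_weak_gradient_lincomb:
  assumes "open \<Omega>" and u: "has_weak_gradient \<Omega> u G" and v: "has_weak_gradient \<Omega> v H"
  shows "has_weak_gradient \<Omega> (\<lambda>x. a * u x + b * v x) (\<lambda>x. a *\<^sub>R G x + b *\<^sub>R H x)"
  unfolding has_weak_gradient_def
proof (intro conjI allI impI)
  note li = u[unfolded has_weak_gradient_def] v[unfolded has_weak_gradient_def]
  show "locally_integrable \<Omega> (\<lambda>x. a * u x + b * v x)"
    using locally_integrable_lincomb[of \<Omega> u v a b] li by simp
  show "locally_integrable \<Omega> (\<lambda>x. a *\<^sub>R G x + b *\<^sub>R H x)"
    using locally_integrable_lincomb li by blast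
  fix \<psi> g assume t: "test_function \<Omega> \<psi> g"
  note int = test_function_integrable[OF \<open>open \<Omega>\<close> t]
  have "(\<integral>x. (a * u x + b * v x) *\<^sub>R g x \<partial>lebesgue_on \<Omega>) =
        a *\<^sub>R (\<integral>x. u x *\<^sub>R g x \<partial>lebesgue_on \<Omega>) + b *\<^sub>R (\<integral>x. v x *\<^sub>R g x \<partial>lebesgue_on \<Omega>)"
    using int(1)[of u] int(1)[of v] li by (simp add: scaleR_left_distrib flip: scaleR_scaleR)
  also have "\<dots> = a *\<^sub>R - (\<integral>x. \<psi> x *\<^sub>R G x \<partial>lebesgue_on \<Omega>) + b *\<^sub>R - (\<integral>x. \<psi> x *\<^sub>R H x \<partial>lebesgue_on \<Omega>)"
    using li t by simp
  also have "\<dots> = - (\<integral>x. a *\<^sub>R (\<psi> x *\<^sub>R G x) + b *\<^sub>R (\<psi> x *\<^sub>R H x) \<partial>lebesgue_on \<Omega>)"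
    using int(2)[of G] int(2)[of H] li by (simp del: scaleR_scaleR)
  finally show "(\<integral>x. (a * u x + b * v x) *\<^sub>R g x \<partial>lebesgue_on \<Omega>) =
      - (\<integral>x. \<psi> x *\<^sub>R (a *\<^sub>R G x + b *\<^sub>R H x) \<partial>lebesgue_on \<Omega>)"
    by (simp add: scaleR_add_right mult.commute)
qed

text \<open>\<open>G - H\<close> is a weak gradient of the zero function, hence orthogonal to all
  test functions.\<close>

lemma has_weak_gradient_unique:
  assumes "open \<Omega>" and "has_weak_gradient \<Omega> u G" "has_weak_gradient \<Omega> u H"
  shows "AE x in lebesgue_on \<Omega>. G x = H x"
proof -
  have *: "has_weak_gradient \<Omega> (\<lambda>x. 1 * u x + (- 1) * u x) (\<lambda>x. 1 *\<^sub>R G x + (- 1) *\<^sub>R H x)"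
    by (rule has_weak_gradient_lincomb[OF assms])
  have "AE x in lebesgue_on \<Omega>. G x - H x = 0"
  proof (rule fundamental_lemma_calculus_of_variations[OF \<open>open \<Omega>\<close>])
    show "locally_integrable \<Omega> (\<lambda>x. G x - H x)"
      using * by (simp add: has_weak_gradient_def)
    show "(\<integral>x. \<psi> x *\<^sub>R (G x - H x) \<partial>lebesgue_on \<Omega>) = 0" if "test_function \<Omega> \<psi> g" for \<psi> g
    proof -
      have "(\<integral>x. 0 *\<^sub>R g x \<partial>lebesgue_on \<Omega>) = - (\<integral>x. \<psi> x *\<^sub>R (G x - H x) \<partial>lebesgue_on \<Omega>)"
        using *[unfolded has_weak_gradient_def, THEN conjunct2, THEN conjunct2, rule_format, OF that] by simp
      then show ?thesis by simp
    qed
  qed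
  then show ?thesis by simp
qed

lemma weak_grad_eq:
  assumes "open \<Omega>" "has_weak_gradient \<Omega> u G"
  shows "AE x in lebesgue_on \<Omega>. weak_grad \<Omega> u x = G x"
proof -
  have "has_weak_gradient \<Omega> u (weak_grad \<Omega> u)"
    unfolding weak_grad_def using assms(2) someI_ex[of "has_weak_gradient \<Omega> u"] by blast
  then show ?thesis by (rule has_weak_gradient_unique[OF assms(1) _ assms(2)])
qed

lemma has_weak_gradient_cong:
  assumes "\<And>x. x \<in> \<Omega> \<Longrightarrow> u x = v x"
  shows "has_weak_gradient \<Omega> u = has_weak_gradient \<Omega> v"
proof -
  have "has_weak_gradient \<Omega> v G" if "has_weak_gradient \<Omega> u G" and eq: "\<And>x. x \<in> \<Omega> \<Longrightarrow> u x = v x" for u v G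
  proof -
    have "(\<integral>x. u x *\<^sub>R g x \<partial>lebesgue_on \<Omega>) = (\<integral>x. v x *\<^sub>R g x \<partial>lebesgue_on \<Omega>)" for g :: "real^'a \<Rightarrow> real^'a"
      by (rule Bochner_Integration.integral_cong) (auto simp: eq)
    moreover have "u absolutely_integrable_on K \<longleftrightarrow> v absolutely_integrable_on K" if "K \<subseteq> \<Omega>" for K
      by (rule set_integrable_cong) (use that eq in auto)
    ultimately show ?thesis
      using that(1) by (simp add: has_weak_gradient_def locally_integrable_def)
  qed
  from this[of u _ v] this[of v _ u] show ?thesis
    using assms by (intro ext) fastforce
qed

text \<open>The two predicates under the choice operator coincide, so the selected gradients are
  equal as functions and not merely almost everywhere.\<close>

lemma weak_grad_cong:
  assumes "\<And>x. x \<in> \<Omega> \<Longrightarrow> u x = v x"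
  shows "weak_grad \<Omega> u = weak_grad \<Omega> v"
  unfolding weak_grad_def using has_weak_gradient_cong[OF assms, of \<Omega>] by simp

lemma grad_form_cong:
  assumes "\<And>x. x \<in> \<Omega> \<Longrightarrow> u x = u' x" "\<And>x. x \<in> \<Omega> \<Longrightarrow> v x = v' x"
  shows "grad_form \<Omega> u v = grad_form \<Omega> u' v'"
proof -
  have "weak_grad \<Omega> u = weak_grad \<Omega> u'" "weak_grad \<Omega> v = weak_grad \<Omega> v'"
    by (rule weak_grad_cong, rule assms, assumption)+
  then show ?thesis by (simp add: grad_form_def)
qed

section \<open>The space \<open>H1\<close> and the gradient form\<close>

lemma H1_has_weak_gradient: "u \<in> H1 \<Omega> \<Longrightarrow> has_weak_gradient \<Omega> u (weak_grad \<Omega> u)"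
  unfolding H1_def weak_grad_def using someI_ex[of "has_weak_gradient \<Omega> u"] by blast

lemma H1_L2: "u \<in> H1 \<Omega> \<Longrightarrow> u \<in> L2 \<Omega>"
  by (simp add: H1_def)

lemma weak_grad_measurable:
  assumes "open \<Omega>" "u \<in> H1 \<Omega>"
  shows "weak_grad \<Omega> u \<in> borel_measurable (lebesgue_on \<Omega>)"
  using H1_has_weak_gradient[OF assms(2)]
  by (intro locally_integrable_measurable[OF assms(1)]) (simp add: has_weak_gradient_def)

lemma H1_lincomb:
  assumes "open \<Omega>" "u \<in> H1 \<Omega>" "v \<in> H1 \<Omega>"
  shows "(\<lambda>x. a * u x + b * v x) \<in> H1 \<Omega>"
proof -
  obtain G H where *: "has_weak_gradient \<Omega> u G" "\<And>i. (\<lambda>x. G x $ i) \<in> L2 \<Omega>"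
      "has_weak_gradient \<Omega> v H" "\<And>i. (\<lambda>x. H x $ i) \<in> L2 \<Omega>"
    using assms by (auto simp: H1_def)
  have "(\<lambda>x. (a *\<^sub>R G x + b *\<^sub>R H x) $ i) \<in> L2 \<Omega>" for i
    using L2_lincomb[OF *(2,4)] by simp
  then show ?thesis
    using has_weak_gradient_lincomb[OF \<open>open \<Omega>\<close> *(1,3)] L2_lincomb assms
    unfolding H1_def by blast
qed

lemma weak_grad_lincomb:
  assumes "open \<Omega>" "u \<in> H1 \<Omega>" "v \<in> H1 \<Omega>"
  shows "AE x in lebesgue_on \<Omega>. weak_grad \<Omega> (\<lambda>x. a * u x + b * v x) x =
           a *\<^sub>R weak_grad \<Omega> u x + b *\<^sub>R weak_grad \<Omega> v x"
  by (rule weak_grad_eq[OF assms(1) has_weak_gradient_lincomb[OF assms(1)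
        H1_has_weak_gradient[OF assms(2)] H1_has_weak_gradient[OF assms(3)]]])

text \<open>\<open>H1\<close> promises square-integrable components for some weak gradient, possibly
  not the selected one; equality almost everywhere carries integrability over.\<close>

lemma weak_grad_square_integrable:
  assumes "open \<Omega>" "u \<in> H1 \<Omega>"
  shows "integrable (lebesgue_on \<Omega>) (\<lambda>x. (norm (weak_grad \<Omega> u x))\<^sup>2)"
proof -
  obtain G where G: "has_weak_gradient \<Omega> u G" "\<And>i. (\<lambda>x. G x $ i) \<in> L2 \<Omega>"
    using assms by (auto simp: H1_def)
  have eq: "(norm (G x))\<^sup>2 = (\<Sum>i\<in>UNIV. (G x $ i)\<^sup>2)" for x
    by (simp add: norm_vec_def L2_set_def sum_nonneg)
  have int: "integrable (lebesgue_on \<Omega>) (\<lambda>x. (norm (G x))\<^sup>2)"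
    unfolding eq using G(2) by (auto simp: L2_def)
  have "AE x in lebesgue_on \<Omega>. weak_grad \<Omega> u x = G x"
    by (rule weak_grad_eq[OF assms(1) G(1)])
  then have "AE x in lebesgue_on \<Omega>. (norm (weak_grad \<Omega> u x))\<^sup>2 = (norm (G x))\<^sup>2"
    by eventually_elim simp
  from integrable_cong_AE[OF _ _ this] int weak_grad_measurable[OF assms] show ?thesis
    by (simp add: borel_measurable_integrable)
qed

lemma grad_form_integrable:
  assumes "open \<Omega>" "u \<in> H1 \<Omega>" "v \<in> H1 \<Omega>"
  shows "integrable (lebesgue_on \<Omega>) (\<lambda>x. weak_grad \<Omega> u x \<bullet> weak_grad \<Omega> v x)"
proof (rule Bochner_Integration.integrable_bound)
  let ?U = "weak_grad \<Omega> u" and ?V = "weak_grad \<Omega> v"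
  show "integrable (lebesgue_on \<Omega>) (\<lambda>x. (norm (?U x))\<^sup>2 + (norm (?V x))\<^sup>2)"
    using assms by (simp add: weak_grad_square_integrable)
  show "(\<lambda>x. ?U x \<bullet> ?V x) \<in> borel_measurable (lebesgue_on \<Omega>)"
    using assms by (intro borel_measurable_inner weak_grad_measurable)
  have "\<bar>?U x \<bullet> ?V x\<bar> \<le> (norm (?U x))\<^sup>2 + (norm (?V x))\<^sup>2" for x
    using sum_squares_bound[of "norm (?U x)" "norm (?V x)"] Cauchy_Schwarz_ineq2[of "?U x" "?V x"]
      zero_le_power2[of "norm (?U x)"] zero_le_power2[of "norm (?V x)"]
    by linarith
  then show "AE x in lebesgue_on \<Omega>. norm (?U x \<bullet> ?V x) \<le> norm ((norm (?U x))\<^sup>2 + (norm (?V x))\<^sup>2)"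
    by (intro AE_I2) simp
qed

lemma grad_form_lincomb_left:
  assumes "open \<Omega>" "u \<in> H1 \<Omega>" "v \<in> H1 \<Omega>" "w \<in> H1 \<Omega>"
  shows "grad_form \<Omega> (\<lambda>x. a * u x + b * v x) w = a * grad_form \<Omega> u w + b * grad_form \<Omega> v w"
proof -
  have "AE x in lebesgue_on \<Omega>. weak_grad \<Omega> (\<lambda>x. a * u x + b * v x) x \<bullet> weak_grad \<Omega> w x =
      a * (weak_grad \<Omega> u x \<bullet> weak_grad \<Omega> w x) + b * (weak_grad \<Omega> v x \<bullet> weak_grad \<Omega> w x)"
    using weak_grad_lincomb[OF assms(1-3), of a b] by eventually_elim (simp add: inner_add_left)
  then have "grad_form \<Omega> (\<lambda>x. a * u x + b * v x) w =
      (\<integral>x. a * (weak_grad \<Omega> u x \<bullet> weak_grad \<Omega> w x) + b * (weak_grad \<Omega> v x \<bullet> weak_grad \<Omega> w x) \<partial>lebesgue_on \<Omega>)"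
    unfolding grad_form_def
    using assms H1_lincomb[OF assms(1-3), of a b] by (intro integral_cong_AE) (intro borel_measurable_add borel_measurable_times borel_measurable_const borel_measurable_inner weak_grad_measurable; simp)+
  then show ?thesis
    using assms by (simp add: grad_form_def grad_form_integrable)
qed

lemma grad_form_commute: "grad_form \<Omega> u v = grad_form \<Omega> v u"
  by (simp add: grad_form_def inner_commute)

lemma grad_form_self: "grad_form \<Omega> u u = (l2_norm \<Omega> (weak_grad \<Omega> u))\<^sup>2"
  by (simp add: grad_form_def l2_norm_def power2_norm_eq_inner)

text \<open>A vanishing seminorm forces the gradient to vanish almost everywhere. This supplies the
  axiom \<open>null\<close> of \<open>semi_inner_functions\<close>.\<close>

lemma grad_form_null:
  assumes "open \<Omega>" "u \<in> H1 \<Omega>" "grad_form \<Omega> u u = 0"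
  shows "grad_form \<Omega> v u = 0"
proof -
  have "AE x in lebesgue_on \<Omega>. weak_grad \<Omega> u x = 0"
    using assms grad_form_integrable[OF assms(1,2,2)]
    by (auto simp: grad_form_def integral_nonneg_eq_0_iff_AE)
  then have "AE x in lebesgue_on \<Omega>. weak_grad \<Omega> v x \<bullet> weak_grad \<Omega> u x = 0"
    by eventually_elim simp
  then show ?thesis
    unfolding grad_form_def by (rule integral_eq_zero_AE)
qed

section \<open>Gradients of Lipschitz functions and piecewise polynomials\<close>

lemma C1_lipschitz_on_compact_convex:
  assumes "C1_with_gradient f F" "compact K" "convex K"
  obtains L where "L-lipschitz_on K f"
proof -
  have "continuous_on K F"
    using assms(1) continuous_on_subset by (auto simp: C1_with_gradient_def)
  then have "bounded (F ` K)"
    by (intro compact_imp_bounded compact_continuous_image assms(2))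
  then obtain B where B: "\<And>x. x \<in> K \<Longrightarrow> norm (F x) \<le> B"
    by (auto simp: bounded_iff)
  \<comment> \<open>The maximum keeps the constant nonnegative if \<open>K\<close> is empty.\<close>
  have "(max B 0)-lipschitz_on K f"
  proof (rule lipschitz_onI)
    fix x y assume xy: "x \<in> K" "y \<in> K"
    have "norm (f x - f y) \<le> max B 0 * norm (x - y)"
    proof (rule differentiable_bound[OF assms(3) _ _ xy])
      show "(f has_derivative (\<lambda>h. h \<bullet> F x)) (at x within K)" if "x \<in> K" for x
        using assms(1) by (auto simp: C1_with_gradient_def gderiv_def intro: has_derivative_at_withinI)
      show "onorm (\<lambda>h. h \<bullet> F x) \<le> max B 0" if "x \<in> K" for x
      proof (rule onorm_bound)
        show "norm (h \<bullet> F x) \<le> max B 0 * norm h" for h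
          using Cauchy_Schwarz_ineq2[of h "F x"] mult_right_mono[OF B[OF that] norm_ge_zero[of h]]
            mult_right_mono[of B "max B 0" "norm h"]
          by (simp add: mult.commute)
      qed simp
    qed
    then show "dist (f x) (f y) \<le> max B 0 * dist x y" by (simp add: dist_norm)
  qed simp
  then show ?thesis by (rule that)
qed

text \<open>Along the segment from \<open>x\<close> to \<open>y\<close> the preimages of the pieces
  are a finite closed cover of [0, 1], and on an interval the constants glue. Covering the whole
  space ensures that the segment never leaves the pieces.\<close>

lemma lipschitz_on_UNIV_finite_closed_cover:
  fixes f :: "'a::real_normed_vector \<Rightarrow> 'b::metric_space"
  assumes "finite I" "\<And>A. A \<in> I \<Longrightarrow> closed A" "\<And>A. A \<in> I \<Longrightarrow> L-lipschitz_on A f"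
    and cover: "\<Union>I = UNIV"
  shows "L-lipschitz_on UNIV f"
proof -
  have "L \<ge> 0" using cover assms(3) lipschitz_on_nonneg by blast
  show ?thesis
  proof (rule lipschitz_onI)
    fix x y :: 'a
    define \<gamma> where "\<gamma> s = x + s *\<^sub>R (y - x)" for s
    have \<gamma>: "dist (\<gamma> s) (\<gamma> t) = norm (y - x) * dist s t" for s t
      by (simp add: \<gamma>_def dist_norm flip: scaleR_left_diff_distrib)
    have cont: "continuous_on UNIV \<gamma>"
      unfolding \<gamma>_def by (intro continuous_intros)
    have "(L * norm (y - x))-lipschitz_on {0..1} (f \<circ> \<gamma>)"
    proof (rule lipschitz_on_closed_Union[where I = I and U = "\<lambda>A. \<gamma> -` A"])
      show "(L * norm (y - x))-lipschitz_on (\<gamma> -` A) (f \<circ> \<gamma>)" if "A \<in> I" for A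
        using lipschitz_onD[OF assms(3)[OF that]] \<open>L \<ge> 0\<close>
        by (intro lipschitz_onI) (simp_all add: mult.assoc flip: \<gamma>)
      show "closed (\<gamma> -` A)" if "A \<in> I" for A
        using assms(2)[OF that] cont by (intro continuous_closed_vimage) (auto simp: continuous_on_eq_continuous_at)
    qed (use assms(1) cover \<open>L \<ge> 0\<close> in auto)
    from lipschitz_onD[OF this, of 0 1] show "dist (f x) (f y) \<le> L * dist x y"
      by (simp add: \<gamma>_def dist_norm norm_minus_commute)
  qed fact
qed

lemma integral_translate_lborel:
  fixes w :: "'a::euclidean_space \<Rightarrow> real"
  assumes "w \<in> borel_measurable borel"
  shows "(\<integral>x. w (c + x) \<partial>lborel) = (\<integral>x. w x \<partial>lborel)"
  using integral_distr[of "(+) c" lborel borel w] assms by (simp add: lborel_distr_plus)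

lemma has_derivative_difference_quotient:
  fixes w :: "'a::real_inner \<Rightarrow> real"
  assumes "(w has_derivative (\<lambda>h. h \<bullet> D)) (at x)"
  shows "(\<lambda>n. (w (inverse (real (Suc n)) *\<^sub>R e + x) - w x) / inverse (real (Suc n))) \<longlonglongrightarrow> D \<bullet> e"
proof -
  have "((\<lambda>t. t *\<^sub>R e + x) has_derivative (\<lambda>t. t *\<^sub>R e)) (at 0)"
    by (auto intro!: derivative_eq_intros)
  moreover have "(w has_derivative (\<lambda>h. h \<bullet> D)) (at (0 *\<^sub>R e + x))"
    using assms by simp
  ultimately have "((\<lambda>t. w (t *\<^sub>R e + x)) has_derivative (\<lambda>t. (t *\<^sub>R e) \<bullet> D)) (at 0)"
    by (rule has_derivative_compose)
  then have "((\<lambda>t. w (t *\<^sub>R e + x)) has_real_derivative D \<bullet> e) (at 0)"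
    by (simp add: has_field_derivative_def inner_commute[of e] mult_commute_abs)
  then have *: "((\<lambda>t. (w (t *\<^sub>R e + x) - w x) / t) \<longlongrightarrow> D \<bullet> e) (at 0)"
    by (simp add: DERIV_def)
  have "filterlim (\<lambda>n. inverse (real (Suc n))) (at 0) sequentially"
    by (simp add: filterlim_at LIMSEQ_inverse_real_of_nat del: of_nat_Suc)
  from filterlim_compose[OF * this] show ?thesis .
qed

text \<open>By translation invariance all difference quotients of \<open>w\<close> have integral 0; the Lipschitz
  bound allows passing to the limit by dominated convergence.\<close>

lemma integral_gradient_of_lipschitz_compact_support:
  fixes w :: "'a::euclidean_space \<Rightarrow> real" and D :: "'a \<Rightarrow> 'a"
  assumes lip: "L-lipschitz_on UNIV w" and supp: "\<And>x. x \<notin> ball 0 R \<Longrightarrow> w x = 0"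
    and D: "integrable lebesgue D"
    and deriv: "AE x in lebesgue. (w has_derivative (\<lambda>h. h \<bullet> D x)) (at x)"
  shows "(\<integral>x. D x \<partial>lebesgue) = 0"
proof (rule euclidean_eqI)
  fix e :: 'a assume e: "e \<in> Basis"
  define h where "h n = inverse (real (Suc n))" for n
  have h: "0 < h n" "h n \<le> 1" for n
    by (auto simp: h_def field_simps)
  define s where "s n x = (w (h n *\<^sub>R e + x) - w x) / h n" for n x
  have w_cont: "continuous_on UNIV w" using lip by (rule lipschitz_on_continuous_on)
  then have w_meas: "w \<in> borel_measurable borel" by (rule borel_measurable_continuous_onI)
  have w_shift_cont: "continuous_on UNIV (\<lambda>x. w (c + x))" for c
    by (rule continuous_on_compose2[OF w_cont]) (auto intro!: continuous_intros)
  have s_meas: "s n \<in> borel_measurable lborel" for n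
    unfolding s_def using w_cont w_shift_cont h(1)[of n]
    by (simp, intro borel_measurable_continuous_onI continuous_intros) auto
  have w_int: "integrable lborel (\<lambda>x. w (c + x))" for c
  proof -
    have "continuous_on (cball (- c) R) (\<lambda>x. w (c + x))"
      using w_shift_cont continuous_on_subset by blast
    then have "integrable lborel (\<lambda>x. indicator (cball (- c) R) x *\<^sub>R w (c + x))"
      by (rule borel_integrable_compact[rotated]) simp
    also have "(\<lambda>x. indicator (cball (- c) R) x *\<^sub>R w (c + x)) = (\<lambda>x. w (c + x))"
    proof
      show "indicator (cball (- c) R) x *\<^sub>R w (c + x) = w (c + x)" for x
        using supp[of "c + x"] by (auto simp: indicator_def dist_norm norm_minus_commute)
    qed
    finally show ?thesis .
  qed
  have "(\<integral>x. s n x \<partial>lebesgue) = 0" for n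
  proof -
    have "(\<integral>x. s n x \<partial>lebesgue) = (\<integral>x. s n x \<partial>lborel)"
      by (rule integral_completion[OF s_meas])
    also have "\<dots> = 0"
      using w_int[of "h n *\<^sub>R e"] w_int[of 0] integral_translate_lborel[OF w_meas]
      by (simp add: s_def)
    finally show ?thesis .
  qed
  \<comment> \<open>The quotients are bounded by \<open>L\<close>, and shifts by at most 1 keep them
    supported in the ball of radius \<open>R + 1\<close>; this is the majorant.\<close>
  moreover have "(\<lambda>n. \<integral>x. s n x \<partial>lebesgue) \<longlonglongrightarrow> (\<integral>x. D x \<bullet> e \<partial>lebesgue)"
  proof (rule integral_dominated_convergence[where w = "\<lambda>x. indicator (ball 0 (R + 1)) x *\<^sub>R L"])
    show "(\<lambda>x. D x \<bullet> e) \<in> borel_measurable lebesgue"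
      using D by (intro borel_measurable_inner) auto
    show "s n \<in> borel_measurable lebesgue" for n
      by (rule measurable_completion[OF s_meas])
    show "integrable lebesgue (\<lambda>x. indicator (ball 0 (R + 1)) x *\<^sub>R L)"
      by (rule integrable_scaleR_left) (simp add: lmeasurable_iff_integrable[symmetric])
    show "AE x in lebesgue. (\<lambda>n. s n x) \<longlonglongrightarrow> D x \<bullet> e"
      using deriv by eventually_elim (simp only: s_def h_def has_derivative_difference_quotient)
    show "AE x in lebesgue. norm (s n x) \<le> indicator (ball 0 (R + 1)) x *\<^sub>R L" for n
    proof (rule AE_I2)
      fix x
      show "norm (s n x) \<le> indicator (ball 0 (R + 1)) x *\<^sub>R L"
      proof (cases "x \<in> ball 0 (R + 1)")
        case True
        have "\<bar>w (h n *\<^sub>R e + x) - w x\<bar> \<le> L * h n"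
          using lipschitz_onD[OF lip, of "h n *\<^sub>R e + x" x] h[of n] e by (simp add: dist_norm)
        then show ?thesis using True h[of n] by (simp add: s_def abs_divide field_simps)
      next
        case False
        have "norm (h n *\<^sub>R e) \<le> 1" using h[of n] e by simp
        then have "R \<le> norm (h n *\<^sub>R e + x)"
          using False norm_diff_ineq[of x "h n *\<^sub>R e"] by (simp add: add.commute)
        then have "w (h n *\<^sub>R e + x) = 0" "w x = 0"
          using False by (auto intro!: supp)
        then show ?thesis using False by (simp add: s_def)
      qed
    qed
  qed
  ultimately have "(\<integral>x. D x \<bullet> e \<partial>lebesgue) = 0"
    by (simp add: LIMSEQ_const_iff)
  then show "(\<integral>x. D x \<partial>lebesgue) \<bullet> e = 0 \<bullet> e"
    using D by simp
qed

section \<open>Polynomials of bounded total degree\<close>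

lemma polys_C1:
  assumes "p \<in> polys q"
  shows "\<exists>g. C1_with_gradient p g"
proof -
  obtain c where p: "p = (\<lambda>x. \<Sum>\<alpha> | sum \<alpha> UNIV \<le> q. c \<alpha> * (\<Prod>i\<in>UNIV. (x $ i) ^ \<alpha> i))"
    using assms by (auto simp: polys_def)
  have "\<exists>F. C1_with_gradient (\<lambda>x. \<Prod>i\<in>UNIV. (x $ i) ^ \<alpha> i) F" for \<alpha> :: "'a \<Rightarrow> nat"
    by (intro C1_prod C1_power[OF C1_coord])
  then have "\<exists>F. C1_with_gradient (\<lambda>x. c \<alpha> * (\<Prod>i\<in>UNIV. (x $ i) ^ \<alpha> i)) F" for \<alpha>
    using C1_mult[OF C1_const] by blast
  then show ?thesis unfolding p by (rule C1_sum)
qed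

lemma polys_lincomb:
  assumes "p \<in> polys q" "r \<in> polys q"
  shows "(\<lambda>x. a * p x + b * r x) \<in> polys q"
proof -
  obtain c d where "p = (\<lambda>x. \<Sum>\<alpha> | sum \<alpha> UNIV \<le> q. c \<alpha> * (\<Prod>i\<in>UNIV. (x $ i) ^ \<alpha> i))"
    "r = (\<lambda>x. \<Sum>\<alpha> | sum \<alpha> UNIV \<le> q. d \<alpha> * (\<Prod>i\<in>UNIV. (x $ i) ^ \<alpha> i))"
    using assms by (auto simp: polys_def)
  then show ?thesis
    unfolding polys_def
    by (auto intro!: exI[of _ "\<lambda>\<alpha>. a * c \<alpha> + b * d \<alpha>"]
        simp: sum_distrib_left distrib_right mult.assoc sum.distrib)
qed

lemma finite_multiindices: "finite {\<alpha> :: 'd::finite \<Rightarrow> nat. sum \<alpha> UNIV \<le> q}"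
proof (rule finite_subset)
  show "{\<alpha> :: 'd \<Rightarrow> nat. sum \<alpha> UNIV \<le> q} \<subseteq> (UNIV \<rightarrow>\<^sub>E {..q})"
  proof (clarsimp simp: PiE_def)
    show "\<alpha> i \<le> q" if "sum \<alpha> UNIV \<le> q" for \<alpha> :: "'d \<Rightarrow> nat" and i
      using member_le_sum[of i UNIV \<alpha>] that by simp
  qed
  show "finite (UNIV \<rightarrow>\<^sub>E {..q} :: ('d \<Rightarrow> nat) set)"
    by (rule finite_PiE) simp_all
qed

lemma const_polys: "(\<lambda>_. c) \<in> (polys q :: (real^'d \<Rightarrow> real) set)"
proof -
  have *: "(if \<alpha> = (\<lambda>_. 0) then c else 0) * (\<Prod>i\<in>UNIV. (x $ i) ^ \<alpha> i) = (if \<alpha> = (\<lambda>_. 0) then c else 0)"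
    for \<alpha> :: "'d \<Rightarrow> nat" and x :: "real^'d" by simp
  show ?thesis
    unfolding polys_def
    by (auto intro!: exI[of _ "\<lambda>\<alpha>. if \<alpha> = (\<lambda>_. 0) then c else 0"]
        simp only: * sum.delta finite_multiindices mem_Collect_eq, simp add: finite_multiindices)
qed

section \<open>One mesh of the family and its finite element functions\<close>

locale fe_mesh =
  fixes \<Omega> :: "(real^'d) set" and T :: "(real^'d) set set"
  assumes open_domain: "open \<Omega>"
    and conforming: "conforming_triangulation \<Omega> T"
begin

lemma finite_mesh: "finite T"
  using conforming by (simp add: conforming_triangulation_def triangulation_def)

lemma cell_compact: "K \<in> T \<Longrightarrow> compact K"
  and cell_convex: "K \<in> T \<Longrightarrow> convex K"
  using compact_simplex[of "int CARD('d)" K] convex_simplex[of "int CARD('d)" K] conforming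
  by (simp_all add: conforming_triangulation_def)

lemma cells_cover: "\<Union>T = closure \<Omega>"
  using conforming by (simp add: conforming_triangulation_def)

text \<open>The intersection of two cells is a face of both, and a face that meets the interior of a
  cell is the whole cell.\<close>

lemma cell_interiors_disjoint:
  assumes "K \<in> T" "K' \<in> T" "x \<in> interior K" "x \<in> interior K'"
  shows "K = K'"
proof -
  have "(K \<inter> K') face_of K" "(K' \<inter> K) face_of K'"
    using conforming assms by (auto simp: conforming_triangulation_def triangulation_def)
  then have "K \<inter> K' = K" "K' \<inter> K = K'"
    using face_of_disjoint_interior[of "K \<inter> K'" K] face_of_disjoint_interior[of "K' \<inter> K" K'] assms interior_subset
    by blast+
  then show ?thesis by blast
qed

lemma bounded_domain: "bounded \<Omega>"
proof -
  have "bounded (\<Union>T)" using finite_mesh cell_compact by (intro bounded_Union) (auto intro: compact_imp_bounded)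
  then show ?thesis using cells_cover closure_subset bounded_subset by metis
qed

lemma lmeasurable_domain: "\<Omega> \<in> lmeasurable"
  by (simp add: lmeasurable_open bounded_domain open_domain)

lemma bounded_measurable_integrable:
  fixes f :: "real^'d \<Rightarrow> 'b::euclidean_space"
  assumes "f \<in> borel_measurable (lebesgue_on \<Omega>)" "\<And>x. x \<in> \<Omega> \<Longrightarrow> norm (f x) \<le> B"
  shows "integrable (lebesgue_on \<Omega>) f"
proof -
  interpret finite_measure "lebesgue_on \<Omega>"
    by (rule finite_measure_lebesgue_on[OF lmeasurable_domain])
  show ?thesis
    by (rule integrable_const_bound[where B = B]) (use assms in \<open>auto intro: AE_I2\<close>)
qed

lemma bounded_measurable_L2:
  assumes "f \<in> borel_measurable (lebesgue_on \<Omega>)" "\<And>x. x \<in> \<Omega> \<Longrightarrow> \<bar>f x\<bar> \<le> B"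
  shows "f \<in> L2 \<Omega>"
proof -
  have "integrable (lebesgue_on \<Omega>) (\<lambda>x. (f x)\<^sup>2)"
    using assms power_mono[OF assms(2), of _ 2]
    by (intro bounded_measurable_integrable[where B = "B\<^sup>2"]) (auto simp: borel_measurable_power)
  then show ?thesis using assms by (simp add: L2_def)
qed

lemma bounded_measurable_locally_integrable:
  fixes f :: "real^'d \<Rightarrow> 'b::euclidean_space"
  assumes "f \<in> borel_measurable (lebesgue_on \<Omega>)" "\<And>x. x \<in> \<Omega> \<Longrightarrow> norm (f x) \<le> B"
  shows "locally_integrable \<Omega> f"
  unfolding locally_integrable_def
proof (intro allI impI)
  fix K assume K: "compact K \<and> K \<subseteq> \<Omega>"
  then have Kl: "K \<in> lmeasurable" by (simp add: lmeasurable_compact)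
  show "f absolutely_integrable_on K"
  proof (rule measurable_bounded_by_integrable_imp_absolutely_integrable)
    show "f \<in> borel_measurable (lebesgue_on K)"
      by (rule measurable_restrict_mono[OF assms(1)]) (use K in simp)
    show "(\<lambda>_. B) integrable_on K" by (rule integrable_on_const[OF Kl])
  qed (use K Kl assms in auto)
qed

lemma fe_space_pieces:
  assumes "u \<in> fe_space \<Omega> T q"
  obtains p where "\<And>K. K \<in> T \<Longrightarrow> p K \<in> polys q" "\<And>K x. K \<in> T \<Longrightarrow> x \<in> K \<inter> \<Omega> \<Longrightarrow> u x = p K x"
proof -
  have "\<forall>K\<in>T. \<exists>p. p \<in> polys q \<and> (\<forall>x\<in>K \<inter> \<Omega>. u x = p x)"
    using assms unfolding fe_space_def by blast
  from bchoice[OF this] obtain p where "\<forall>K\<in>T. p K \<in> polys q \<and> (\<forall>x\<in>K \<inter> \<Omega>. u x = p K x)" ..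
  then show ?thesis by (intro that[of p]) simp_all
qed

text \<open>The function is tied to a polynomial only on the part of a cell inside \<Omega>, but the
  polynomial is bounded on the whole compact cell, and the cells are finitely many.\<close>

lemma fe_space_bounded:
  assumes "u \<in> fe_space \<Omega> T q"
  obtains B where "\<And>x. x \<in> \<Omega> \<Longrightarrow> \<bar>u x\<bar> \<le> B"
proof -
  obtain p where p: "\<And>K. K \<in> T \<Longrightarrow> p K \<in> polys q" "\<And>K x. K \<in> T \<Longrightarrow> x \<in> K \<inter> \<Omega> \<Longrightarrow> u x = p K x"
    by (rule fe_space_pieces[OF assms]) blast
  have "bounded (p K ` K)" if "K \<in> T" for K
    using polys_C1[OF p(1)[OF that]] cell_compact[OF that]
    by (auto intro: compact_imp_bounded compact_continuous_image C1_continuous)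
  then have "bounded (\<Union>K\<in>T. p K ` K)"
    by (intro bounded_UN finite_mesh) simp
  then obtain B where B: "\<And>y. y \<in> (\<Union>K\<in>T. p K ` K) \<Longrightarrow> \<bar>y\<bar> \<le> B"
    by (auto simp: bounded_iff)
  have "\<bar>u x\<bar> \<le> B" if x: "x \<in> \<Omega>" for x
  proof -
    obtain K where "K \<in> T" "x \<in> K"
      using x cells_cover closure_subset[of \<Omega>] by blast
    then show ?thesis using x p(2)[of K x] by (intro B) auto
  qed
  then show ?thesis by (rule that)
qed

lemma fe_space_measurable: "u \<in> fe_space \<Omega> T q \<Longrightarrow> u \<in> borel_measurable (lebesgue_on \<Omega>)"
  using continuous_imp_measurable_on_sets_lebesgue[of \<Omega> u] open_domain by (simp add: fe_space_def)

lemma fe_space_lincomb: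
  assumes "u \<in> fe_space \<Omega> T q" "v \<in> fe_space \<Omega> T q"
  shows "(\<lambda>x. a * u x + b * v x) \<in> fe_space \<Omega> T q"
proof -
  obtain p where p: "\<And>K. K \<in> T \<Longrightarrow> p K \<in> polys q" "\<And>K x. K \<in> T \<Longrightarrow> x \<in> K \<inter> \<Omega> \<Longrightarrow> u x = p K x"
    by (rule fe_space_pieces[OF assms(1)]) blast
  obtain r where r: "\<And>K. K \<in> T \<Longrightarrow> r K \<in> polys q" "\<And>K x. K \<in> T \<Longrightarrow> x \<in> K \<inter> \<Omega> \<Longrightarrow> v x = r K x"
    by (rule fe_space_pieces[OF assms(2)]) blast
  have "\<exists>p\<in>polys q. \<forall>x\<in>K \<inter> \<Omega>. a * u x + b * v x = p x" if K: "K \<in> T" for K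
    using p(2)[OF K] r(2)[OF K]
    by (intro bexI[of _ "\<lambda>x. a * p K x + b * r K x"] polys_lincomb p(1)[OF K] r(1)[OF K]) simp
  moreover have "continuous_on \<Omega> (\<lambda>x. a * u x + b * v x)"
    using assms by (auto simp: fe_space_def intro!: continuous_on_add continuous_on_mult_left)
  ultimately show ?thesis by (simp add: fe_space_def)
qed

lemma const_fe_space: "(\<lambda>_. c) \<in> fe_space \<Omega> T q"
  unfolding fe_space_def by (auto intro!: bexI[OF _ const_polys])

end

section \<open>Weak gradients of finite element functions\<close>

context fe_mesh
begin

text \<open>Cell interiors are disjoint, so at most one summand is nonzero; off them the value is 0,
  which inside \<Omega> concerns only a null set. Writing it as a finite sum makes measurability and
  boundedness immediate.\<close>

definition cellwise_gradient :: "((real^'d) set \<Rightarrow> real^'d \<Rightarrow> real^'d) \<Rightarrow> real^'d \<Rightarrow> real^'d" where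
  "cellwise_gradient g x = (\<Sum>K\<in>T. indicator (interior K) x *\<^sub>R g K x)"

lemma cellwise_gradient_interior:
  assumes "K \<in> T" "x \<in> interior K"
  shows "cellwise_gradient g x = g K x"
proof -
  have "cellwise_gradient g x = (\<Sum>K'\<in>T. if K' = K then g K x else 0)"
    unfolding cellwise_gradient_def
    by (rule sum.cong) (use assms cell_interiors_disjoint in \<open>auto simp: indicator_def\<close>)
  then show ?thesis using assms finite_mesh by simp
qed

lemma cellwise_gradient_measurable:
  assumes "\<And>K. K \<in> T \<Longrightarrow> C1_with_gradient (p K) (g K)"
  shows "cellwise_gradient g \<in> borel_measurable borel"
  unfolding cellwise_gradient_def
proof (intro borel_measurable_sum borel_measurable_scaleR borel_measurable_indicator)
  show "g K \<in> borel_measurable borel" if "K \<in> T" for K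
    using assms[OF that] by (simp add: C1_with_gradient_def borel_measurable_continuous_onI)
qed simp

lemma cellwise_gradient_bounded:
  assumes "\<And>K. K \<in> T \<Longrightarrow> C1_with_gradient (p K) (g K)"
  obtains B where "\<And>x. norm (cellwise_gradient g x) \<le> B"
proof -
  have "\<exists>B. \<forall>x\<in>K. norm (g K x) \<le> B" if "K \<in> T" for K
  proof -
    have "continuous_on K (g K)"
      using assms[OF that] continuous_on_subset[of UNIV "g K" K] by (simp add: C1_with_gradient_def)
    then have "bounded (g K ` K)"
      by (intro compact_imp_bounded compact_continuous_image cell_compact that)
    then show ?thesis by (simp add: bounded_iff)
  qed
  then obtain B where B: "\<And>K x. K \<in> T \<Longrightarrow> x \<in> K \<Longrightarrow> norm (g K x) \<le> B K"
    by metis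
  have "norm (cellwise_gradient g x) \<le> (\<Sum>K\<in>T. \<bar>B K\<bar>)" for x
    unfolding cellwise_gradient_def
  proof (rule order_trans[OF norm_sum], rule sum_mono)
    show "norm (indicator (interior K) x *\<^sub>R g K x) \<le> \<bar>B K\<bar>" if "K \<in> T" for K
      using B[OF that, of x] interior_subset[of K] by (auto simp: indicator_def)
  qed
  then show ?thesis by (rule that)
qed

lemma AE_cell_interior_or_outside:
  "AE x in lebesgue. (\<exists>K\<in>T. x \<in> interior K) \<or> x \<notin> closure \<Omega>"
proof -
  have "AE x in lebesgue. x \<notin> frontier K" if "K \<in> T" for K
    using negligible_convex_frontier[OF cell_convex[OF that]] by (auto simp: negligible_iff_null_sets intro: AE_not_in)
  then have "AE x in lebesgue. \<forall>K\<in>T. x \<notin> frontier K"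
    using finite_mesh by (simp add: AE_finite_all)
  then show ?thesis
  proof eventually_elim
    case (elim x)
    then show ?case
      using closure_subset by (fastforce simp: frontier_def simp flip: cells_cover)
  qed
qed

text \<open>The cells and the complement of the open domain form a finite closed cover of the space:
  on each compact convex cell \<open>w\<close> is C^1, on the complement it is 0.\<close>

lemma piecewise_C1_times_test_function_lipschitz:
  assumes "\<And>K. K \<in> T \<Longrightarrow> C1_with_gradient (p K) (g K)"
    and "\<And>K x. K \<in> T \<Longrightarrow> x \<in> K \<Longrightarrow> w x = p K x * \<psi> x"
    and "\<And>x. x \<notin> \<Omega> \<Longrightarrow> w x = 0" "C1_with_gradient \<psi> \<gamma>"
  obtains L where "L-lipschitz_on UNIV w"
proof -
  have "\<exists>L. L-lipschitz_on K w" if K: "K \<in> T" for K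
  proof -
    obtain L where "L-lipschitz_on K (\<lambda>x. p K x * \<psi> x)"
      using C1_lipschitz_on_compact_convex[OF C1_mult[OF assms(1)[OF K] assms(4)] cell_compact[OF K] cell_convex[OF K]] .
    then have "L-lipschitz_on K w"
      by (rule lipschitz_on_transform) (use assms(2)[OF K] in simp)
    then show ?thesis ..
  qed
  then obtain L where L: "\<And>K. K \<in> T \<Longrightarrow> (L K)-lipschitz_on K w" by metis
  have L0: "K \<in> T \<Longrightarrow> 0 \<le> L K" for K using L lipschitz_on_nonneg by blast
  have "(\<Sum>K\<in>T. L K)-lipschitz_on UNIV w"
  proof (rule lipschitz_on_UNIV_finite_closed_cover[where I = "insert (- \<Omega>) T"])
    show "(\<Sum>K\<in>T. L K)-lipschitz_on A w" if A: "A \<in> insert (- \<Omega>) T" for A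
    proof (cases "A \<in> T")
      case True
      have "L A \<le> (\<Sum>K\<in>T. L K)" using L0 True finite_mesh by (intro member_le_sum) auto
      then show ?thesis by (rule lipschitz_on_mono[OF L[OF True] order_refl])
    next
      case False
      then have "A = - \<Omega>" using A by simp
      then show ?thesis using assms(3) L0 by (intro lipschitz_onI) (auto simp: sum_nonneg)
    qed
    show "closed A" if "A \<in> insert (- \<Omega>) T" for A
      using that open_domain cell_compact by (auto simp: closed_Compl compact_imp_closed)
    show "\<Union>(insert (- \<Omega>) T) = UNIV"
      using cells_cover closure_subset[of \<Omega>] by auto
  qed (simp add: finite_mesh)
  then show ?thesis by (rule that)
qed

text \<open>For a test function \<open>\<psi>\<close>, the product \<open>u \<psi>\<close> extended by zero is Lipschitz with compact
  support, so that the integral of its gradient vanishes.\<close>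

lemma piecewise_C1_has_weak_gradient:
  assumes p: "\<And>K. K \<in> T \<Longrightarrow> C1_with_gradient (p K) (g K)"
    and u: "\<And>K x. K \<in> T \<Longrightarrow> x \<in> K \<inter> \<Omega> \<Longrightarrow> u x = p K x"
    and loc: "locally_integrable \<Omega> u"
  shows "has_weak_gradient \<Omega> u (cellwise_gradient g)"
proof -
  let ?G = "cellwise_gradient g"
  obtain B where B: "\<And>x. norm (?G x) \<le> B"
    by (rule cellwise_gradient_bounded[of p g]) (use p in auto)
  have "?G \<in> borel_measurable (lebesgue_on \<Omega>)"
    using cellwise_gradient_measurable[of p g] p
    by (intro measurable_restrict_space1 measurable_completion) simp
  then have locG: "locally_integrable \<Omega> ?G"
    using B by (rule bounded_measurable_locally_integrable)
  have "(\<integral>x. u x *\<^sub>R \<gamma> x \<partial>lebesgue_on \<Omega>) = - (\<integral>x. \<psi> x *\<^sub>R ?G x \<partial>lebesgue_on \<Omega>)"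
    if t: "test_function \<Omega> \<psi> \<gamma>" for \<psi> \<gamma>
  proof -
    have out: "\<psi> x = 0" "\<gamma> x = 0" if "x \<notin> \<Omega>" for x
      using test_function_zero_outside[OF t, of x] that t by auto
    define w where "w x = (if x \<in> \<Omega> then u x * \<psi> x else 0)" for x
    \<comment> \<open>The product rule for \<open>u * \<psi>\<close>: the candidate for the gradient
      of \<open>w\<close>.\<close>
    define D where "D x = \<psi> x *\<^sub>R ?G x + u x *\<^sub>R \<gamma> x" for x
    \<comment> \<open>This holds on all of \<open>K\<close>, also at points outside \<Omega>,
      because \<open>\<psi>\<close> vanishes there.\<close>
    have wK: "w x = p K x * \<psi> x" if "K \<in> T" "x \<in> K" for K x
      using u[OF that(1), of x] that out by (auto simp: w_def)
    have w0: "w x = 0" if "x \<notin> \<Omega>" for x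
      using that by (simp add: w_def)
    have D0: "D x = 0" if "x \<notin> \<Omega>" for x
      using that out by (simp add: D_def)
    note int = test_function_integrable[OF open_domain t]
    have intD: "integrable (lebesgue_on \<Omega>) D"
      unfolding D_def using int(1)[OF loc] int(2)[OF locG] by simp
    have ind: "indicator \<Omega> x *\<^sub>R D x = D x" for x
      using D0[of x] by (simp add: indicator_def)
    have "integrable lebesgue D"
      using intD open_domain by (subst (asm) integrable_restrict_space) (simp_all add: ind)
    moreover obtain L where "L-lipschitz_on UNIV w"
      by (rule piecewise_C1_times_test_function_lipschitz[where w = w and p = p and g = g and \<psi> = \<psi> and \<gamma> = \<gamma>])
        (use p wK w0 t in auto)
    moreover obtain R where "\<Omega> \<subseteq> ball 0 R"
      using bounded_domain bounded_subset_ballD by blast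
    then have "w x = 0" if "x \<notin> ball 0 R" for x
      using that w0 by blast
    moreover have "AE x in lebesgue. (w has_derivative (\<lambda>h. h \<bullet> D x)) (at x)"
      using AE_cell_interior_or_outside
    proof eventually_elim
      case (elim x)
      then show ?case
      proof
        assume "\<exists>K\<in>T. x \<in> interior K"
        then obtain K where K: "K \<in> T" "x \<in> interior K" by blast
        then have "x \<in> K" using interior_subset by blast
        have "C1_with_gradient (\<lambda>x. p K x * \<psi> x) (\<lambda>x. p K x *\<^sub>R \<gamma> x + \<psi> x *\<^sub>R g K x)"
          using C1_mult[OF p[OF K(1)]] t by blast
        then have "((\<lambda>x. p K x * \<psi> x) has_derivative (\<lambda>h. h \<bullet> (p K x *\<^sub>R \<gamma> x + \<psi> x *\<^sub>R g K x))) (at x)"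
          by (simp add: C1_with_gradient_def gderiv_def)
        moreover have "p K x *\<^sub>R \<gamma> x + \<psi> x *\<^sub>R g K x = D x"
          using K cellwise_gradient_interior[OF K] out[of x] u[OF K(1), of x] \<open>x \<in> K\<close>
          by (cases "x \<in> \<Omega>") (simp_all add: D_def add.commute)
        ultimately have "((\<lambda>x. p K x * \<psi> x) has_derivative (\<lambda>h. h \<bullet> D x)) (at x)"
          by simp
        then show ?thesis
        proof (rule has_derivative_transform_within_open[where s = "interior K"])
          show "p K y * \<psi> y = w y" if "y \<in> interior K" for y
            using wK[OF K(1)] that interior_subset[of K] by auto
        qed (use K in auto)
      next
        assume x: "x \<notin> closure \<Omega>"
        have "((\<lambda>_. 0) has_derivative (\<lambda>_. 0)) (at x)" by simp
        moreover have "D x = 0" using x closure_subset[of \<Omega>] by (intro D0) auto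
        ultimately have "((\<lambda>_. 0) has_derivative (\<lambda>h. h \<bullet> D x)) (at x)" by simp
        then show ?thesis
        proof (rule has_derivative_transform_within_open[where s = "- closure \<Omega>"])
          show "0 = w y" if "y \<in> - closure \<Omega>" for y
            using that closure_subset[of \<Omega>] w0[of y] by auto
        qed (use x in \<open>simp_all add: open_Compl\<close>)
      qed
    qed
    ultimately have "(\<integral>x. D x \<partial>lebesgue) = 0"
      by (intro integral_gradient_of_lipschitz_compact_support[of L w R])
    moreover have "(\<integral>x. D x \<partial>lebesgue_on \<Omega>) = (\<integral>x. D x \<partial>lebesgue)"
      using open_domain by (subst integral_restrict_space) (simp_all add: ind)
    moreover have "(\<integral>x. D x \<partial>lebesgue_on \<Omega>) =
        (\<integral>x. \<psi> x *\<^sub>R ?G x \<partial>lebesgue_on \<Omega>) + (\<integral>x. u x *\<^sub>R \<gamma> x \<partial>lebesgue_on \<Omega>)"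
      unfolding D_def using int(1)[OF loc] int(2)[OF locG] by simp
    ultimately show ?thesis by (simp add: add_eq_0_iff)
  qed
  then show ?thesis using loc locG by (simp add: has_weak_gradient_def)
qed

lemma fe_space_subset_H1: "fe_space \<Omega> T q \<subseteq> H1 \<Omega>"
proof
  fix u assume u: "u \<in> fe_space \<Omega> T q"
  obtain B where B: "\<And>x. x \<in> \<Omega> \<Longrightarrow> \<bar>u x\<bar> \<le> B"
    by (rule fe_space_bounded[OF u]) blast
  obtain p where p: "\<And>K. K \<in> T \<Longrightarrow> p K \<in> polys q" "\<And>K x. K \<in> T \<Longrightarrow> x \<in> K \<inter> \<Omega> \<Longrightarrow> u x = p K x"
    by (rule fe_space_pieces[OF u]) blast
  have "\<forall>K\<in>T. \<exists>g. C1_with_gradient (p K) g" using p(1) polys_C1 by blast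
  from bchoice[OF this] obtain g where g: "\<forall>K\<in>T. C1_with_gradient (p K) (g K)" ..
  have "locally_integrable \<Omega> u"
    by (rule bounded_measurable_locally_integrable[OF fe_space_measurable[OF u]]) (use B in simp)
  then have G: "has_weak_gradient \<Omega> u (cellwise_gradient g)"
    using g p(2) by (intro piecewise_C1_has_weak_gradient[of p g u]) auto
  obtain C where C: "\<And>x. norm (cellwise_gradient g x) \<le> C"
    by (rule cellwise_gradient_bounded[of p g]) (use g in auto)
  have "cellwise_gradient g \<in> borel_measurable (lebesgue_on \<Omega>)"
    using cellwise_gradient_measurable[of p g] g
    by (intro measurable_restrict_space1 measurable_completion) simp
  then have "(\<lambda>x. cellwise_gradient g x $ i) \<in> borel_measurable (lebesgue_on \<Omega>)" for i
    by (simp add: borel_measurable_inner cart_eq_inner_axis)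
  moreover have "\<bar>cellwise_gradient g x $ i\<bar> \<le> C" for x i
    using component_le_norm_cart[of "cellwise_gradient g x" i] C[of x] by linarith
  ultimately have "(\<lambda>x. cellwise_gradient g x $ i) \<in> L2 \<Omega>" for i
    by (rule bounded_measurable_L2)
  moreover have "u \<in> L2 \<Omega>"
    by (rule bounded_measurable_L2[OF fe_space_measurable[OF u] B])
  ultimately show "u \<in> H1 \<Omega>" using G by (auto simp: H1_def)
qed

end

section \<open>Discrete Laplacian and Ritz projection\<close>

text \<open>A zero L2 norm gives vanishing only almost everywhere. The functional \<xi> \<mapsto>
  -a(v, \<xi>) must nevertheless vanish on such functions before it can be represented in the L2
  product.\<close>

lemma weak_grad_AE_zero:
  assumes "open \<Omega>" "u \<in> H1 \<Omega>" and zero: "AE x in lebesgue_on \<Omega>. u x = 0"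
  shows "AE x in lebesgue_on \<Omega>. weak_grad \<Omega> u x = 0"
proof (rule weak_grad_eq[OF assms(1)])
  have "(\<integral>x. u x *\<^sub>R g x \<partial>lebesgue_on \<Omega>) = 0" for g :: "real^'a \<Rightarrow> real^'a"
    by (rule integral_eq_zero_AE) (use zero in eventually_elim, simp)
  then show "has_weak_gradient \<Omega> u (\<lambda>_. 0)"
    using H1_has_weak_gradient[OF assms(2)]
    by (simp add: has_weak_gradient_def locally_integrable_def set_integrable_def)
qed

lemma grad_form_AE_zero_right:
  assumes "AE x in lebesgue_on \<Omega>. weak_grad \<Omega> u x = 0"
  shows "grad_form \<Omega> v u = 0"
  unfolding grad_form_def by (rule integral_eq_zero_AE) (use assms in eventually_elim, simp)

lemma l2_inner_null:
  assumes "u \<in> L2 \<Omega>" "l2_inner \<Omega> u u = 0"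
  shows "l2_inner \<Omega> v u = 0"
  unfolding l2_inner_def
  by (rule integral_eq_zero_AE) (use l2_inner_self_eq_0[OF assms] in eventually_elim, simp)

text \<open>Common frame for the L2 product, which cannot see values outside \<Omega>, and the
  gradient form, whose kernel also contains the constants. In place of definiteness,
  \<open>null\<close> says that functions of seminorm 0 are orthogonal to everything.\<close>

locale semi_inner_functions =
  fixes V :: "('a \<Rightarrow> real) set" and B :: "('a \<Rightarrow> real) \<Rightarrow> ('a \<Rightarrow> real) \<Rightarrow> real"
  assumes lincomb: "u \<in> V \<Longrightarrow> v \<in> V \<Longrightarrow> (\<lambda>x. a * u x + b * v x) \<in> V"
    and left: "u \<in> V \<Longrightarrow> v \<in> V \<Longrightarrow> w \<in> V \<Longrightarrow>
      B (\<lambda>x. a * u x + b * v x) w = a * B u w + b * B v w"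
    and commute: "B u v = B v u"
    and null: "u \<in> V \<Longrightarrow> v \<in> V \<Longrightarrow> B u u = 0 \<Longrightarrow> B v u = 0"
begin

lemma right:
  "u \<in> V \<Longrightarrow> v \<in> V \<Longrightarrow> w \<in> V \<Longrightarrow> B w (\<lambda>x. a * u x + b * v x) = a * B w u + b * B w v"
  by (simp add: left commute[of w])

text \<open>\<open>W\<close> relates functions to coordinate vectors (not necessarily unique). Induction on the number
  of coordinates: a function with nonzero \<open>i\<close>-th coordinate is orthogonalised against the
  functions whose \<open>i\<close>-th coordinate vanishes.\<close>

lemma riesz_finite_coordinates:
  fixes W :: "(('a \<Rightarrow> real) \<times> ('i \<Rightarrow> real)) set"
  assumes "finite I" and "fst ` W \<subseteq> V" and "W \<noteq> {}"
    and "\<And>a b u c v d. (u, c) \<in> W \<Longrightarrow> (v, d) \<in> W \<Longrightarrow>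
      (\<lambda>x. a * u x + b * v x, \<lambda>i. a * c i + b * d i) \<in> W"
    and "\<And>u c. (u, c) \<in> W \<Longrightarrow> \<forall>i\<in>I. c i = 0 \<Longrightarrow> B u u = 0"
    and "\<And>a b u v. u \<in> V \<Longrightarrow> v \<in> V \<Longrightarrow> l (\<lambda>x. a * u x + b * v x) = a * l u + b * l v"
    and "\<And>u. u \<in> V \<Longrightarrow> B u u = 0 \<Longrightarrow> l u = 0"
  shows "\<exists>u\<in>fst ` W. \<forall>v\<in>fst ` W. B u v = l v"
  using assms
proof (induction I arbitrary: W l rule: finite_induct)
  case empty
  obtain u c where u: "(u, c) \<in> W" using \<open>W \<noteq> {}\<close> by auto
  \<comment> \<open>Without coordinates every function in \<open>W\<close> has seminorm 0, so both
    sides vanish and any element will do.\<close>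
  have "B u v = l v" if "v \<in> fst ` W" for v
  proof -
    have "B v v = 0" using that empty(4) by auto
    moreover have "u \<in> V" "v \<in> V" using u that empty(1) by force+
    ultimately show ?thesis using null[of v u] empty(6)[of v] by simp
  qed
  then show ?case using u by force
next
  case (insert i I)
  note WV = insert.prems(1) and W_lin = insert.prems(3) and W_null = insert.prems(4)
    and l_lin = insert.prems(5) and l_null = insert.prems(6)
  show ?case
  proof (cases "\<exists>b d. (b, d) \<in> W \<and> d i \<noteq> 0")
    case False
    show ?thesis
    proof (rule insert.IH[OF WV insert.prems(2) W_lin _ l_lin l_null])
      show "B u u = 0" if "(u, c) \<in> W" "\<forall>j\<in>I. c j = 0" for u c
        using False that by (intro W_null[OF that(1)]) auto
    qed
  next
    case True
    then obtain b d where b: "(b, d) \<in> W" "d i \<noteq> 0" by blast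
    define W' where "W' = {(u, c). (u, c) \<in> W \<and> c i = 0}"
    have W'_sub: "fst ` W' \<subseteq> fst ` W" by (auto simp: W'_def)
    have V: "u \<in> V" if "(u, c) \<in> W" for u c using that WV by force
    have IH: "\<exists>u\<in>fst ` W'. \<forall>v\<in>fst ` W'. B u v = m v"
      if m: "\<And>a b u v. u \<in> V \<Longrightarrow> v \<in> V \<Longrightarrow> m (\<lambda>x. a * u x + b * v x) = a * m u + b * m v"
        "\<And>u. u \<in> V \<Longrightarrow> B u u = 0 \<Longrightarrow> m u = 0" for m
    proof (rule insert.IH[OF _ _ _ _ m])
      show "fst ` W' \<subseteq> V" using W'_sub WV by blast
      show "W' \<noteq> {}" using W_lin[OF b(1) b(1), of 0 0] by (auto simp: W'_def)
      show "(\<lambda>x. a * u x + b * v x, \<lambda>i. a * c i + b * d i) \<in> W'" if "(u, c) \<in> W'" "(v, d) \<in> W'" for a b u c v d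
        using that W_lin[of u c v d a b] by (simp add: W'_def)
      show "B u u = 0" if "(u, c) \<in> W'" "\<forall>j\<in>I. c j = 0" for u c
        using that by (intro W_null[of u c]) (auto simp: W'_def)
    qed
    obtain w where w: "w \<in> fst ` W'" "\<And>v. v \<in> fst ` W' \<Longrightarrow> B w v = l v"
      using IH[of l, OF l_lin l_null] by blast
    have bV: "b \<in> V" using V b(1) .
    \<comment> \<open>Representing the functional \<open>B b\<close> on \<open>W'\<close> yields a
      projection of \<open>b\<close> onto the functions with vanishing \<open>i\<close>-th
      coordinate.\<close>
    obtain e where e: "e \<in> fst ` W'" "\<And>v. v \<in> fst ` W' \<Longrightarrow> B e v = B b v"
      using IH[of "B b"] right[OF _ _ bV] null[OF _ bV] by blast
    obtain ce where ce: "(e, ce) \<in> W" "ce i = 0" using e(1) by (auto simp: W'_def)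
    obtain cw where cw: "(w, cw) \<in> W" using w(1) by (auto simp: W'_def)
    \<comment> \<open>Subtracting the projection makes \<open>f\<close> orthogonal to
      \<open>W'\<close> and keeps the nonzero \<open>i\<close>-th coordinate of
      \<open>b\<close>.\<close>
    define f where "f x = 1 * b x + (- 1) * e x" for x
    define df where "df j = 1 * d j + (- 1) * ce j" for j
    have f: "(f, df) \<in> W" unfolding f_def df_def by (rule W_lin[OF b(1) ce(1)])
    have dfi: "df i \<noteq> 0" using b(2) ce(2) by (simp add: df_def)
    have f_orth: "B f v = 0" if "v \<in> fst ` W'" for v
    proof -
      have "v \<in> V" using that W'_sub WV by blast
      then show ?thesis
        unfolding f_def using left[OF bV V[OF ce(1)] \<open>v \<in> V\<close>, of 1 "- 1"] e(2)[OF that] by simp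
    qed
    have fV: "f \<in> V" and wV: "w \<in> V" using V f cw by blast+
    \<comment> \<open>Moving \<open>w\<close> along \<open>f\<close> does not change its products
      with \<open>W'\<close>, and \<open>s\<close> solves B (w + s f) f = l f. If
      \<open>B f f = 0\<close>, division yields \<open>s = 0\<close>, and both sides vanish by
      \<open>null\<close> and \<open>l_null\<close>.\<close>
    define s where "s = (l f - B w f) / B f f"
    define u where "u x = 1 * w x + s * f x" for x
    have u: "(u, \<lambda>j. 1 * cw j + s * df j) \<in> W" unfolding u_def by (rule W_lin[OF cw f])
    have uf: "B u f = l f"
    proof (cases "B f f = 0")
      case True
      then show ?thesis using null[OF fV V[OF u]] l_null[OF fV] by simp
    next
      case False
      then show ?thesis unfolding u_def using left[OF wV fV fV, of 1 s] by (simp add: s_def)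
    qed
    have "B u v = l v" if "v \<in> fst ` W" for v
    proof -
      obtain c where c: "(v, c) \<in> W" using \<open>v \<in> fst ` W\<close> by auto
      \<comment> \<open>Chosen so that v - t f has \<open>i\<close>-th coordinate 0 and falls into
        \<open>W'\<close>.\<close>
      define t where "t = c i / df i"
      define v' where "v' x = 1 * v x + (- t) * f x" for x
      have v'W: "(v', \<lambda>j. 1 * c j + (- t) * df j) \<in> W" unfolding v'_def by (rule W_lin[OF c f])
      then have v'W': "v' \<in> fst ` W'" using dfi by (force simp: W'_def t_def)
      have v'V: "v' \<in> V" using V v'W .
      have v: "v = (\<lambda>x. 1 * v' x + t * f x)" by (simp add: v'_def fun_eq_iff)
      have "B u v' = l v'"
        unfolding u_def using left[OF wV fV v'V, of 1 s] f_orth[OF v'W'] w(2)[OF v'W'] by simp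
      then show ?thesis
        using uf right[OF v'V fV V[OF u], of 1 t] l_lin[OF v'V fV, of 1 t] unfolding v[symmetric] by simp
    qed
    then show ?thesis using u by force
  qed
qed

end

context fe_mesh
begin

text \<open>The coordinates are the monomial coefficients on each cell. If all of them are 0, the
  function vanishes on \<Omega> but is arbitrary outside, which is why \<open>zero\<close> is
  assumed of \<open>B\<close>.\<close>

lemma fe_space_riesz:
  assumes "semi_inner_functions (fe_space \<Omega> T q) B"
    and zero: "\<And>u. u \<in> fe_space \<Omega> T q \<Longrightarrow> (\<And>x. x \<in> \<Omega> \<Longrightarrow> u x = 0) \<Longrightarrow> B u u = 0"
    and l: "\<And>a b u v. u \<in> fe_space \<Omega> T q \<Longrightarrow> v \<in> fe_space \<Omega> T q \<Longrightarrow>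
      l (\<lambda>x. a * u x + b * v x) = a * l u + b * l v"
    "\<And>u. u \<in> fe_space \<Omega> T q \<Longrightarrow> B u u = 0 \<Longrightarrow> l u = 0"
  shows "\<exists>w\<in>fe_space \<Omega> T q. \<forall>v\<in>fe_space \<Omega> T q. B w v = l v"
proof -
  interpret semi_inner_functions "fe_space \<Omega> T q" B by fact
  define A where "A = {\<alpha> :: 'd \<Rightarrow> nat. sum \<alpha> UNIV \<le> q}"
  define m where "m \<alpha> x = (\<Prod>i\<in>UNIV. (x $ i) ^ \<alpha> i)" for \<alpha> :: "'d \<Rightarrow> nat" and x :: "real^'d"
  define W where "W = {(u, c). u \<in> fe_space \<Omega> T q \<and>
    (\<forall>K\<in>T. \<forall>x\<in>K \<inter> \<Omega>. u x = (\<Sum>\<alpha>\<in>A. c (K, \<alpha>) * m \<alpha> x))}"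
  have S: "fst ` W = fe_space \<Omega> T q"
  proof
    show "fst ` W \<subseteq> fe_space \<Omega> T q" by (auto simp: W_def)
    show "fe_space \<Omega> T q \<subseteq> fst ` W"
    proof
      fix u assume u: "u \<in> fe_space \<Omega> T q"
      obtain p where p: "\<And>K. K \<in> T \<Longrightarrow> p K \<in> polys q" "\<And>K x. K \<in> T \<Longrightarrow> x \<in> K \<inter> \<Omega> \<Longrightarrow> u x = p K x"
        by (rule fe_space_pieces[OF u]) blast
      have "\<forall>K\<in>T. \<exists>c. p K = (\<lambda>x. \<Sum>\<alpha>\<in>A. c \<alpha> * m \<alpha> x)"
        using p(1) by (simp add: polys_def A_def m_def)
      from bchoice[OF this] obtain c where c: "\<forall>K\<in>T. p K = (\<lambda>x. \<Sum>\<alpha>\<in>A. c K \<alpha> * m \<alpha> x)" ..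
      have "u x = (\<Sum>\<alpha>\<in>A. case_prod c (K, \<alpha>) * m \<alpha> x)" if "K \<in> T" "x \<in> K \<inter> \<Omega>" for K x
        using p(2)[OF that] fun_cong[OF c[rule_format, OF that(1)], of x] by simp
      then have "(u, case_prod c) \<in> W" using u unfolding W_def by blast
      then show "u \<in> fst ` W" by force
    qed
  qed
  have "\<exists>u\<in>fst ` W. \<forall>v\<in>fst ` W. B u v = l v"
  proof (rule riesz_finite_coordinates[where I = "T \<times> A"])
    show "finite (T \<times> A)" by (simp add: A_def finite_mesh finite_multiindices)
    show "W \<noteq> {}" using S const_fe_space by blast
    show "(\<lambda>x. a * u x + b * v x, \<lambda>i. a * c i + b * d i) \<in> W" if "(u, c) \<in> W" "(v, d) \<in> W" for a b u c v d
      using that fe_space_lincomb[of u q v a b]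
      by (simp add: W_def distrib_right mult.assoc sum.distrib sum_distrib_left)
    show "B u u = 0" if uc: "(u, c) \<in> W" and c: "\<forall>i\<in>T \<times> A. c i = 0" for u c
    proof (rule zero)
      show "u \<in> fe_space \<Omega> T q" using uc by (simp add: W_def)
      fix x assume x: "x \<in> \<Omega>"
      then obtain K where K: "K \<in> T" "x \<in> K" using cells_cover closure_subset[of \<Omega>] by blast
      then have "u x = (\<Sum>\<alpha>\<in>A. c (K, \<alpha>) * m \<alpha> x)" using uc x by (simp add: W_def)
      then show "u x = 0" using c K by simp
    qed
  qed (use S l in auto)
  then show ?thesis by (simp add: S)
qed

lemma fe_space_H1: "u \<in> fe_space \<Omega> T q \<Longrightarrow> u \<in> H1 \<Omega>"
  using fe_space_subset_H1 by blast

lemma fe_space_L2: "u \<in> fe_space \<Omega> T q \<Longrightarrow> u \<in> L2 \<Omega>"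
  by (simp add: fe_space_H1 H1_L2)

lemma grad_form_lincomb_right:
  assumes "u \<in> H1 \<Omega>" "v \<in> H1 \<Omega>" "w \<in> H1 \<Omega>"
  shows "grad_form \<Omega> w (\<lambda>x. a * u x + b * v x) = a * grad_form \<Omega> w u + b * grad_form \<Omega> w v"
  using grad_form_lincomb_left[OF open_domain assms] by (simp add: grad_form_commute)

lemma l2_inner_semi_inner: "semi_inner_functions (fe_space \<Omega> T q) (l2_inner \<Omega>)"
  by unfold_locales
    (rule fe_space_lincomb l2_inner_lincomb_left l2_inner_commute l2_inner_null; simp add: fe_space_L2)+

lemma grad_form_semi_inner: "semi_inner_functions (fe_space \<Omega> T q) (grad_form \<Omega>)"
  by unfold_locales
    (rule fe_space_lincomb grad_form_lincomb_left grad_form_commute grad_form_null;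
      simp add: fe_space_H1 open_domain)+

lemma grad_form_zero_right:
  assumes "u \<in> H1 \<Omega>" "AE x in lebesgue_on \<Omega>. u x = 0"
  shows "grad_form \<Omega> v u = 0"
  by (rule grad_form_AE_zero_right[OF weak_grad_AE_zero[OF open_domain assms]])

text \<open>Constants are piecewise C^1 with zero cell gradients. This makes the discrete Laplacian
  mean-free and lets the Ritz projection be shifted to the right mean.\<close>

lemma grad_form_const_right: "grad_form \<Omega> v (\<lambda>_. c) = 0"
proof (rule grad_form_AE_zero_right)
  have "has_weak_gradient \<Omega> (\<lambda>_. c) (cellwise_gradient (\<lambda>_ _. 0))"
  proof (rule piecewise_C1_has_weak_gradient)
    show "C1_with_gradient (\<lambda>_. c) (\<lambda>_. 0)" by (rule C1_const)
    show "locally_integrable \<Omega> (\<lambda>_. c)"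
      by (rule bounded_measurable_locally_integrable[where B = "\<bar>c\<bar>"]) simp_all
  qed simp
  moreover have "cellwise_gradient (\<lambda>_ _. 0) = (\<lambda>_. 0)"
    by (simp add: fun_eq_iff cellwise_gradient_def)
  ultimately have "has_weak_gradient \<Omega> (\<lambda>_. c) (\<lambda>_. 0)" by simp
  then show "AE x in lebesgue_on \<Omega>. weak_grad \<Omega> (\<lambda>_. c) x = 0"
    by (rule weak_grad_eq[OF open_domain])
qed

text \<open>The functional \<xi> \<mapsto> -a(v, \<xi>) is represented in the L2 product; testing
  with 1 gives zero mean. Existence makes the choice operator meet its specification.\<close>

lemma discrete_laplacian:
  assumes v: "v \<in> fe_space \<Omega> T q"
  shows "discrete_laplacian \<Omega> (fe_space \<Omega> T q) v \<in> fe_space \<Omega> T q"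
    and "\<xi> \<in> fe_space \<Omega> T q \<Longrightarrow>
      l2_inner \<Omega> (discrete_laplacian \<Omega> (fe_space \<Omega> T q) v) \<xi> = - grad_form \<Omega> v \<xi>"
proof -
  let ?S = "fe_space \<Omega> T q"
  have "\<exists>w\<in>?S. \<forall>\<xi>\<in>?S. l2_inner \<Omega> w \<xi> = - grad_form \<Omega> v \<xi>"
  proof (rule fe_space_riesz[OF l2_inner_semi_inner])
    show "l2_inner \<Omega> u u = 0" if "\<And>x. x \<in> \<Omega> \<Longrightarrow> u x = 0" for u
      using l2_inner_cong[of \<Omega> u "\<lambda>_. 0" u "\<lambda>_. 0"] that by (simp add: l2_inner_def)
    show "- grad_form \<Omega> v (\<lambda>x. a * u x + b * w x) = a * - grad_form \<Omega> v u + b * - grad_form \<Omega> v w"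
      if "u \<in> ?S" "w \<in> ?S" for a b u w
      using that v by (simp add: grad_form_lincomb_right fe_space_H1)
    show "- grad_form \<Omega> v u = 0" if "u \<in> ?S" "l2_inner \<Omega> u u = 0" for u
      using that by (simp add: grad_form_zero_right fe_space_H1 fe_space_L2 l2_inner_self_eq_0)
  qed
  then obtain w where w: "w \<in> ?S" "\<forall>\<xi>\<in>?S. l2_inner \<Omega> w \<xi> = - grad_form \<Omega> v \<xi>" by blast
  have "l2_inner \<Omega> w (\<lambda>_. 1) = 0"
    using w(2) const_fe_space[of 1 q] by (simp add: grad_form_const_right)
  then have "\<exists>w. w \<in> zero_mean \<Omega> ?S \<and> (\<forall>\<xi>\<in>?S. l2_inner \<Omega> w \<xi> = - grad_form \<Omega> v \<xi>)"
    using w by (auto simp: zero_mean_def)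
  from someI_ex[OF this]
  have "discrete_laplacian \<Omega> ?S v \<in> zero_mean \<Omega> ?S \<and>
      (\<forall>\<xi>\<in>?S. l2_inner \<Omega> (discrete_laplacian \<Omega> ?S v) \<xi> = - grad_form \<Omega> v \<xi>)"
    unfolding discrete_laplacian_def .
  then show "discrete_laplacian \<Omega> ?S v \<in> ?S"
    and "\<xi> \<in> ?S \<Longrightarrow> l2_inner \<Omega> (discrete_laplacian \<Omega> ?S v) \<xi> = - grad_form \<Omega> v \<xi>"
    by (simp_all add: zero_mean_def)
qed

text \<open>The gradient form does not see constants, so a constant shift of a representer remains
  free to adjust the mean.\<close>

lemma ritz_projection_fe_space:
  assumes \<phi>: "\<phi> \<in> H1 \<Omega>"
  shows "ritz_projection \<Omega> (fe_space \<Omega> T q) \<phi> \<in> fe_space \<Omega> T q"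
proof -
  let ?S = "fe_space \<Omega> T q"
  have "\<exists>w\<in>?S. \<forall>\<xi>\<in>?S. grad_form \<Omega> w \<xi> = grad_form \<Omega> \<phi> \<xi>"
  proof (rule fe_space_riesz[OF grad_form_semi_inner])
    show "grad_form \<Omega> u u = 0" if "\<And>x. x \<in> \<Omega> \<Longrightarrow> u x = 0" for u
      using grad_form_cong[of \<Omega> u "\<lambda>_. 0" u "\<lambda>_. 0"] that by (simp add: grad_form_const_right)
    show "grad_form \<Omega> \<phi> (\<lambda>x. a * u x + b * w x) = a * grad_form \<Omega> \<phi> u + b * grad_form \<Omega> \<phi> w"
      if "u \<in> ?S" "w \<in> ?S" for a b u w
      using that \<phi> by (simp add: grad_form_lincomb_right fe_space_H1)
    show "grad_form \<Omega> \<phi> u = 0" if "u \<in> ?S" "grad_form \<Omega> u u = 0" for u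
      using that by (simp add: grad_form_null open_domain fe_space_H1)
  qed
  then obtain w where w: "w \<in> ?S" "\<And>\<xi>. \<xi> \<in> ?S \<Longrightarrow> grad_form \<Omega> w \<xi> = grad_form \<Omega> \<phi> \<xi>" by blast
  let ?one = "\<lambda>_ :: real^'d. 1 :: real"
  have one: "?one \<in> ?S" by (rule const_fe_space)
  define e where "e x = 1 * w x + (- 1) * \<phi> x" for x
  have e: "e \<in> H1 \<Omega>" unfolding e_def by (rule H1_lincomb[OF open_domain fe_space_H1[OF w(1)] \<phi>])
  \<comment> \<open>The shift that cancels the mean of \<open>e\<close>. If (1, 1) = 0, the quotient
    is 0 by convention, and (e, 1) is already 0.\<close>
  define k where "k = - l2_inner \<Omega> e ?one / l2_inner \<Omega> ?one ?one"
  define r where "r x = 1 * w x + k * 1" for x :: "real^'d"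
  have "r \<in> ?S" unfolding r_def by (rule fe_space_lincomb[OF w(1) one])
  have r: "(\<lambda>x. r x - \<phi> x) = (\<lambda>x. 1 * e x + k * 1)" by (simp add: r_def e_def fun_eq_iff)
  have "grad_form \<Omega> (\<lambda>x. r x - \<phi> x) \<xi> = 0" if \<xi>: "\<xi> \<in> ?S" for \<xi>
  proof -
    have "grad_form \<Omega> e \<xi> = 0"
      unfolding e_def
      using grad_form_lincomb_left[OF open_domain fe_space_H1[OF w(1)] \<phi> fe_space_H1[OF \<xi>], of 1 "- 1"] w(2)[OF \<xi>]
      by simp
    then show ?thesis
      unfolding r
      using grad_form_lincomb_left[OF open_domain e fe_space_H1[OF one] fe_space_H1[OF \<xi>], of 1 k]
      by (simp add: grad_form_commute[of _ ?one] grad_form_const_right)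
  qed
  moreover have "l2_inner \<Omega> (\<lambda>x. r x - \<phi> x) ?one = 0"
  proof -
    have "l2_inner \<Omega> (\<lambda>x. r x - \<phi> x) ?one = l2_inner \<Omega> e ?one + k * l2_inner \<Omega> ?one ?one"
      unfolding r using l2_inner_lincomb_left[OF H1_L2[OF e] fe_space_L2[OF one] fe_space_L2[OF one], of 1 k] by simp
    moreover have "l2_inner \<Omega> e ?one = 0" if "l2_inner \<Omega> ?one ?one = 0"
      using that by (rule l2_inner_null[OF fe_space_L2[OF one]])
    ultimately show ?thesis by (cases "l2_inner \<Omega> ?one ?one = 0") (simp_all add: k_def)
  qed
  ultimately have "\<exists>w. w \<in> ?S \<and> (\<forall>\<xi>\<in>?S. grad_form \<Omega> (\<lambda>x. w x - \<phi> x) \<xi> = 0) \<and>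
      l2_inner \<Omega> (\<lambda>x. w x - \<phi> x) ?one = 0"
    using \<open>r \<in> ?S\<close> by blast
  from someI_ex[OF this] show ?thesis unfolding ritz_projection_def by blast
qed

end

section \<open>The energy inequality\<close>

context fe_mesh
begin

lemma fe_space_bounded_measurable:
  assumes "u \<in> fe_space \<Omega> T q"
  obtains B where "u \<in> borel_measurable (lebesgue_on \<Omega>)" "\<And>x. x \<in> \<Omega> \<Longrightarrow> \<bar>u x\<bar> \<le> B" "0 \<le> B"
proof -
  obtain B where B: "\<And>x. x \<in> \<Omega> \<Longrightarrow> \<bar>u x\<bar> \<le> B" by (rule fe_space_bounded[OF assms]) blast
  then have "x \<in> \<Omega> \<Longrightarrow> \<bar>u x\<bar> \<le> \<bar>B\<bar>" for x by fastforce
  then show ?thesis using fe_space_measurable[OF assms] that[of "\<bar>B\<bar>"] by simp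
qed

lemma fe_space_square_L2:
  assumes "u \<in> fe_space \<Omega> T q"
  shows "(\<lambda>x. (u x)\<^sup>2) \<in> L2 \<Omega>"
proof -
  obtain B where B: "u \<in> borel_measurable (lebesgue_on \<Omega>)" "\<And>x. x \<in> \<Omega> \<Longrightarrow> \<bar>u x\<bar> \<le> B" "0 \<le> B"
    by (rule fe_space_bounded_measurable[OF assms]) blast
  show ?thesis
  proof (rule bounded_measurable_L2)
    show "(\<lambda>x. (u x)\<^sup>2) \<in> borel_measurable (lebesgue_on \<Omega>)" using B(1) by (rule borel_measurable_power)
    show "\<bar>(u x)\<^sup>2\<bar> \<le> B\<^sup>2" if "x \<in> \<Omega>" for x
      using power_mono[OF B(2)[OF that], of 2] by simp
  qed
qed

lemma fe_space_double_well_integrable: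
  assumes u: "u \<in> fe_space \<Omega> T q"
  shows "integrable (lebesgue_on \<Omega>) (\<lambda>x. ((u x)\<^sup>2 - 1)\<^sup>2)"
proof -
  have "(\<lambda>x. 1 * (u x)\<^sup>2 + (- 1) * 1) \<in> L2 \<Omega>"
    by (rule L2_lincomb[OF fe_space_square_L2[OF u] fe_space_L2[OF const_fe_space]])
  then show ?thesis by (simp add: L2_def)
qed

lemma energy_fe_space:
  assumes u: "u \<in> fe_space \<Omega> T q"
  shows "energy \<Omega> \<epsilon> u = 1 / (4 * \<epsilon>) * (\<integral>x. ((u x)\<^sup>2 - 1)\<^sup>2 \<partial>lebesgue_on \<Omega>) + \<epsilon> / 2 * grad_form \<Omega> u u"
  using fe_space_double_well_integrable[OF u] weak_grad_square_integrable[OF open_domain fe_space_H1[OF u]]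
  by (simp add: energy_def grad_form_def power2_norm_eq_inner)

text \<open>The integrated form of
  \<open>(u\<^sup>2 - 1)\<^sup>2 - (v\<^sup>2 - 1)\<^sup>2 = 4 \<chi>(u, v) (u - v) - 4 v (u - v) - 2 (u - v)\<^sup>2\<close>:
  \<open>\<chi>\<close> is the discrete gradient of the quartic part, and treating the concave part explicitly
  leaves a square with a favourable sign.\<close>

lemma double_well_difference:
  assumes u: "u \<in> fe_space \<Omega> T q" and v: "v \<in> fe_space \<Omega> T q"
  shows "(\<integral>x. ((u x)\<^sup>2 - 1)\<^sup>2 \<partial>lebesgue_on \<Omega>) - (\<integral>x. ((v x)\<^sup>2 - 1)\<^sup>2 \<partial>lebesgue_on \<Omega>) =
    4 * l2_inner \<Omega> (\<lambda>x. chi (u x) (v x)) (\<lambda>x. u x - v x) - 4 * l2_inner \<Omega> v (\<lambda>x. u x - v x)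
    - 2 * l2_inner \<Omega> (\<lambda>x. u x - v x) (\<lambda>x. u x - v x)"
proof -
  let ?d = "\<lambda>x. u x - v x"
  have d: "?d \<in> fe_space \<Omega> T q" using fe_space_lincomb[OF u v, of 1 "- 1"] by simp
  note iu = fe_space_double_well_integrable[OF u] and iv = fe_space_double_well_integrable[OF v]
  have ivd: "integrable (lebesgue_on \<Omega>) (\<lambda>x. v x * ?d x)"
    and idd: "integrable (lebesgue_on \<Omega>) (\<lambda>x. ?d x * ?d x)"
    using L2_mult_integrable[OF fe_space_L2[OF v] fe_space_L2[OF d]]
      L2_mult_integrable[OF fe_space_L2[OF d] fe_space_L2[OF d]] .
  \<comment> \<open>Solved for the \<open>chi\<close> term, so that its integral comes from
    functions already known to be integrable.\<close>
  have eq: "chi (u x) (v x) * ?d x =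
      ((u x)\<^sup>2 - 1)\<^sup>2 / 4 - ((v x)\<^sup>2 - 1)\<^sup>2 / 4 + v x * ?d x + ?d x * ?d x / 2" for x
    by (simp add: chi_def field_simps power2_eq_square)
  have "l2_inner \<Omega> (\<lambda>x. chi (u x) (v x)) ?d =
      (\<integral>x. ((u x)\<^sup>2 - 1)\<^sup>2 \<partial>lebesgue_on \<Omega>) / 4 - (\<integral>x. ((v x)\<^sup>2 - 1)\<^sup>2 \<partial>lebesgue_on \<Omega>) / 4
      + l2_inner \<Omega> v ?d + l2_inner \<Omega> ?d ?d / 2"
    unfolding l2_inner_def eq using iu iv ivd idd by simp
  then show ?thesis by simp
qed

end

theorem lemma2p4:
  fixes \<Omega> :: "(real^'d) set" and H :: "real set" and T :: "real \<Rightarrow> (real^'d) set set"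
    and q :: nat and \<epsilon> \<tau> h :: real and S :: "(real^'d \<Rightarrow> real) set"
    and \<phi>0 \<mu>0 \<phi>h0 \<mu>h0 \<phi>h1 \<mu>h :: "real^'d \<Rightarrow> real"
  assumes "CARD('d) \<in> {2, 3}"
    and "polyhedral_domain \<Omega>"
    and "\<epsilon> > 0"
    and "mesh_family \<Omega> H T"
    and "q \<ge> 1"
    and "h \<in> H"
    and "\<tau> > 0"
    and "S = fe_space \<Omega> (T h) q"
    and "\<phi>0 \<in> H2 \<Omega>"
    and "zero_normal_derivative \<Omega> \<phi>0"
    and "\<mu>0 = (\<lambda>x. 1 / \<epsilon> * ((\<phi>0 x)^3 - \<phi>0 x) - \<epsilon> * laplacian \<Omega> \<phi>0 x)"
    and "\<mu>0 \<in> H1 \<Omega>"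
    and "\<phi>h0 = ritz_projection \<Omega> S \<phi>0"
    and "\<mu>h0 = ritz_projection \<Omega> S \<mu>0"
    and "\<phi>h1 \<in> S"
    and "\<mu>h \<in> S"
    and "\<forall>\<nu>\<in>S. l2_inner \<Omega> (\<lambda>x. (\<phi>h1 x - \<phi>h0 x) / \<tau>) \<nu> + \<epsilon> * grad_form \<Omega> \<mu>h \<nu> = 0"
    and "\<forall>\<psi>\<in>S. 1 / \<epsilon> * l2_inner \<Omega> (\<lambda>x. chi (\<phi>h1 x) (\<phi>h0 x)) \<psi> - 1 / \<epsilon> * l2_inner \<Omega> \<phi>h0 \<psi>
              + \<tau> / 2 * grad_form \<Omega> \<mu>h0 \<psi>
              + \<epsilon> * grad_form \<Omega> (\<lambda>x. 1/2 * \<phi>h1 x + 1/2 * \<phi>h0 x) \<psi>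
              - l2_inner \<Omega> \<mu>h \<psi> = 0"
  shows "energy \<Omega> \<epsilon> \<phi>h1 + \<tau> * \<epsilon> * (l2_norm \<Omega> (weak_grad \<Omega> \<mu>h))\<^sup>2
           + 1 / (4 * \<epsilon>) * (l2_norm \<Omega> (\<lambda>x. \<phi>h1 x - \<phi>h0 x))\<^sup>2
         \<le> energy \<Omega> \<epsilon> \<phi>h0
           + \<epsilon> * \<tau>\<^sup>2 / 4 * (l2_norm \<Omega> (discrete_laplacian \<Omega> S \<mu>h0))\<^sup>2"
proof -
  interpret fe_mesh \<Omega> "T h"
    using assms(2,4,6) by unfold_locales (auto simp: polyhedral_domain_def mesh_family_def)
  note S = \<open>S = fe_space \<Omega> (T h) q\<close>
  let ?l = "l2_inner \<Omega>" and ?a = "grad_form \<Omega>"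
  \<comment> \<open>Both projections lie in \<open>S\<close>, so the increment \<open>d\<close> is
    an admissible test function and the discrete Laplacian applies to
    \<open>\<mu>h0\<close>.\<close>
  have \<phi>h0: "\<phi>h0 \<in> S" and \<mu>h0: "\<mu>h0 \<in> S"
    using assms(9,12-14) ritz_projection_fe_space by (simp_all add: S H2_def)
  note \<phi>h1 = \<open>\<phi>h1 \<in> S\<close> and \<mu>h = \<open>\<mu>h \<in> S\<close> and \<epsilon> = \<open>\<epsilon> > 0\<close> and \<tau> = \<open>\<tau> > 0\<close>
  note L2 = fe_space_L2[of _ q, folded S] and H1 = fe_space_H1[of _ q, folded S]
    and lincomb = fe_space_lincomb[of _ q, folded S]
  define d where "d = (\<lambda>x. \<phi>h1 x - \<phi>h0 x)"
  have d_lincomb: "d = (\<lambda>x. 1 * \<phi>h1 x + (- 1) * \<phi>h0 x)" by (simp add: d_def fun_eq_iff)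
  have d: "d \<in> S" unfolding d_lincomb by (rule lincomb[OF \<phi>h1 \<phi>h0])
  define \<Delta> where "\<Delta> = discrete_laplacian \<Omega> S \<mu>h0"
  have \<Delta>: "\<Delta> \<in> S" "?l \<Delta> d = - ?a \<mu>h0 d"
    unfolding \<Delta>_def using discrete_laplacian[of \<mu>h0 q] \<mu>h0 d by (simp_all add: S)

  have "?l (\<lambda>x. (1 / \<tau>) * d x + 0 * d x) \<mu>h = 1 / \<tau> * ?l d \<mu>h + 0 * ?l d \<mu>h"
    by (rule l2_inner_lincomb_left[OF L2[OF d] L2[OF d] L2[OF \<mu>h]])
  then have "?l d \<mu>h = \<tau> * ?l (\<lambda>x. d x / \<tau>) \<mu>h"
    using \<tau> by (simp add: field_simps)
  moreover have "?l (\<lambda>x. d x / \<tau>) \<mu>h = - (\<epsilon> * ?a \<mu>h \<mu>h)"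
    using assms(17)[rule_format, OF \<mu>h] by (simp add: d_def add_eq_0_iff)
  ultimately have eq1: "?l d \<mu>h = - (\<tau> * \<epsilon> * ?a \<mu>h \<mu>h)"
    by simp

  \<comment> \<open>With the midpoint in one slot the symmetric form telescopes: a((u + v)/2, u - v)
    = (a(u, u) - a(v, v))/2.\<close>
  have grad: "?a (\<lambda>x. 1/2 * \<phi>h1 x + 1/2 * \<phi>h0 x) d = 1/2 * ?a \<phi>h1 \<phi>h1 - 1/2 * ?a \<phi>h0 \<phi>h0"
  proof -
    have "?a (\<lambda>x. 1/2 * \<phi>h1 x + 1/2 * \<phi>h0 x) d = 1/2 * ?a \<phi>h1 d + 1/2 * ?a \<phi>h0 d"
      by (rule grad_form_lincomb_left[OF open_domain H1[OF \<phi>h1] H1[OF \<phi>h0] H1[OF d]])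
    moreover have "?a w d = 1 * ?a w \<phi>h1 + (- 1) * ?a w \<phi>h0" if "w \<in> S" for w
      unfolding d_lincomb by (rule grad_form_lincomb_right[OF H1[OF \<phi>h1] H1[OF \<phi>h0] H1[OF that]])
    from this[OF \<phi>h1] this[OF \<phi>h0]
    have "?a \<phi>h1 d = ?a \<phi>h1 \<phi>h1 - ?a \<phi>h1 \<phi>h0" "?a \<phi>h0 d = ?a \<phi>h1 \<phi>h0 - ?a \<phi>h0 \<phi>h0"
      by (simp_all add: grad_form_commute[of \<Omega> \<phi>h0 \<phi>h1])
    ultimately show ?thesis by linarith
  qed
  have eq2: "1 / \<epsilon> * ?l (\<lambda>x. chi (\<phi>h1 x) (\<phi>h0 x)) d - 1 / \<epsilon> * ?l \<phi>h0 d - \<tau> / 2 * ?l \<Delta> d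
      + \<epsilon> * (1/2 * ?a \<phi>h1 \<phi>h1 - 1/2 * ?a \<phi>h0 \<phi>h0) - ?l d \<mu>h = 0"
    using assms(18)[rule_format, OF d] unfolding grad \<Delta>(2) l2_inner_commute[of \<Omega> d \<mu>h] by simp

  have "energy \<Omega> \<epsilon> \<phi>h1 - energy \<Omega> \<epsilon> \<phi>h0 = 1 / (4 * \<epsilon>) *
      (4 * ?l (\<lambda>x. chi (\<phi>h1 x) (\<phi>h0 x)) d - 4 * ?l \<phi>h0 d - 2 * ?l d d)
      + \<epsilon> / 2 * ?a \<phi>h1 \<phi>h1 - \<epsilon> / 2 * ?a \<phi>h0 \<phi>h0"
    using right_diff_distrib[of "1 / (4 * \<epsilon>)" "\<integral>x. ((\<phi>h1 x)\<^sup>2 - 1)\<^sup>2 \<partial>lebesgue_on \<Omega>"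
        "\<integral>x. ((\<phi>h0 x)\<^sup>2 - 1)\<^sup>2 \<partial>lebesgue_on \<Omega>"]
    unfolding double_well_difference[OF \<phi>h1[unfolded S] \<phi>h0[unfolded S], folded d_def]
      energy_fe_space[OF \<phi>h1[unfolded S]] energy_fe_space[OF \<phi>h0[unfolded S]]
    by linarith
  also have "\<dots> = 1 / \<epsilon> * ?l (\<lambda>x. chi (\<phi>h1 x) (\<phi>h0 x)) d - 1 / \<epsilon> * ?l \<phi>h0 d
      + \<epsilon> * (1/2 * ?a \<phi>h1 \<phi>h1 - 1/2 * ?a \<phi>h0 \<phi>h0) - 1 / (2 * \<epsilon>) * ?l d d"
    using \<epsilon> by (simp add: field_simps)
  also have "\<dots> = \<tau> / 2 * ?l \<Delta> d + ?l d \<mu>h - 1 / (2 * \<epsilon>) * ?l d d"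
    using eq2 by linarith
  finally have balance: "energy \<Omega> \<epsilon> \<phi>h1 - energy \<Omega> \<epsilon> \<phi>h0 =
      \<tau> / 2 * ?l \<Delta> d - \<tau> * \<epsilon> * ?a \<mu>h \<mu>h - 1 / (2 * \<epsilon>) * ?l d d"
    unfolding eq1 by simp

  have young: "\<tau> / 2 * ?l \<Delta> d \<le> 1 / (4 * \<epsilon>) * ?l d d + \<epsilon> * \<tau>\<^sup>2 / 4 * ?l \<Delta> \<Delta>"
  proof -
    \<comment> \<open>The inequality is (d - \<epsilon>\<tau>\<Delta>, d - \<epsilon>\<tau>\<Delta>)
      \<ge> 0 divided by 4\<epsilon>, which produces both the factor 1/(4\<epsilon>) and the factor
      \<epsilon>\<tau>^2/4.\<close>
    let ?s = "- (\<epsilon> * \<tau>)"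
    let ?z = "\<lambda>x. 1 * d x + ?s * \<Delta> x"
    have z: "?l ?z w = 1 * ?l d w + ?s * ?l \<Delta> w" if "w \<in> S" for w
      by (rule l2_inner_lincomb_left[OF L2[OF d] L2[OF \<Delta>(1)] L2[OF that]])
    have "?l ?z ?z = 1 * ?l d ?z + ?s * ?l \<Delta> ?z"
      by (rule z[OF lincomb[OF d \<Delta>(1)]])
    also have "\<dots> = ?l d d + 2 * ?s * ?l \<Delta> d + ?s\<^sup>2 * ?l \<Delta> \<Delta>"
      unfolding l2_inner_commute[of \<Omega> _ ?z] z[OF d] z[OF \<Delta>(1)] l2_inner_commute[of \<Omega> d \<Delta>]
      by (simp add: algebra_simps power2_eq_square)
    finally have "0 \<le> (?l d d + 2 * ?s * ?l \<Delta> d + ?s\<^sup>2 * ?l \<Delta> \<Delta>) / (4 * \<epsilon>)"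
      using l2_inner_self_nonneg[of \<Omega> ?z] \<epsilon> by simp
    then show ?thesis
      using \<epsilon> by (simp add: field_simps power2_eq_square)
  qed
  \<comment> \<open>One half is spent on Young's inequality, the other is the increment term of the
    claim.\<close>
  have "1 / (2 * \<epsilon>) * ?l d d = 1 / (4 * \<epsilon>) * ?l d d + 1 / (4 * \<epsilon>) * ?l d d"
    by (simp add: field_simps)
  then show ?thesis
    using balance young unfolding grad_form_self[symmetric] l2_norm_square \<Delta>_def[symmetric] d_def[symmetric]
    by linarith
qed

end
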